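(* Let $\mathrm{H}=H^{*}(\mathbb{Z}/2\mathbb{Z};\mathbb{F}_2)=\mathbb{F}_2[t]$ with $|t|=1$, and let $E$ be an unstable $\mathrm{H}$-$A$-module which is free as an $\mathrm{H}$-module and such that $\overline{E}=\mathbb{F}_2\otimes_{\mathrm{H}}E$ is isomorphic, as an unstable $A$-module, to the Brown-Gitler module $\mathrm{J}(2)$. Then, up to isomorphism of unstable $\mathrm{H}$-$A$-modules, either $E\cong\mathrm{H}\otimes\mathrm{J}(2)$, or $E$ is the sub-$\mathrm{H}$-$A$-module of $\mathrm{H}\oplus\Sigma\mathrm{H}$ generated by $(t,\Sigma 1)$ and $(t^{2},0)$.
   Context: $A$ is the mod 2 Steenrod algebra; $\mathcal{U}$ is the category of unstable $A$-modules (graded $A$-modules $M$ with $Sq^ix=0$ for $i>|x|$) and degree-zero $A$-linear maps. An unstable $\mathrm{H}$-$A$-module is an unstable $A$-module $E$ with a graded $\mathrm{H}$-module structure whose action map $\mathrm{H}\otimes E\to E$ is $A$-linear (with the diagonal, Cartan formula, action on the tensor product); morphisms are degree-zero maps that are $\mathrm{H}$-linear and $A$-linear. $\overline{E}=E/(\widetilde{\mathrm{H}}\cdot E)$ with $\widetilde{\mathrm{H}}$ the augmentation ideal. For an unstable $A$-module $M$, $\mathrm{H}\otimes M$ (tensor product over $\mathbb{F}_2$) has the diagonal $A$-action and $\mathrm{H}$ acts on the left factor. $\Sigma$ denotes suspension: $(\Sigma N)^k=N^{k-1}$, $Sq^i\Sigma x=\Sigma Sq^ix$, $h\cdot\Sigma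 x=\Sigma(hx)$. The Brown-Gitler module $\mathrm{J}(n)$ is the unstable $A$-module characterized up to isomorphism by the bijection, functorial in the unstable $A$-module $M$, $\mathrm{Hom}_{\mathcal{U}}(M,\mathrm{J}(n))\cong\mathrm{Hom}_{\mathbb{F}_2}(M^{n},\mathbb{F}_2)$. *)

theory Defs
  imports
    "HOL-Algebra.Module"
    "HOL-Algebra.AbelCoset"
    "HOL-Algebra.Algebraic_Closure_Type"
    "HOL-Computational_Algebra.Polynomial"
    "HOL-Library.Z2"
    "HOL-Library.Poly_Mapping"
begin

section \<open>Vector spaces over \<open>F\<^sub>2\<close>\<close>

abbreviation F2 :: "bit ring"
  where "F2 \<equiv> ring_of_type_algebra"

text \<open>The fields \<open>mult\<close> and \<open>one\<close> of the record \<open>module\<close> have no meaning for a module.\<close>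

definition vsp :: "'a set \<Rightarrow> 'a \<Rightarrow> ('a \<Rightarrow> 'a \<Rightarrow> 'a) \<Rightarrow> (bit \<Rightarrow> 'a \<Rightarrow> 'a) \<Rightarrow> (bit, 'a) module"
  where "vsp C z a s =
    \<lparr>carrier = C, monoid.mult = undefined, monoid.one = undefined, ring.zero = z, ring.add = a, module.smult = s\<rparr>"

definition F2_space :: "(bit, bit) module"
  where "F2_space = vsp UNIV 0 (+) (*)"

definition linear_map :: "(bit, 'a) module \<Rightarrow> (bit, 'b) module \<Rightarrow> ('a \<Rightarrow> 'b) \<Rightarrow> bool"
  where "linear_map V W f \<longleftrightarrow>
    f \<in> hom (add_monoid V) (add_monoid W) \<and>
    (\<forall>c. \<forall>x\<in>carrier V. f (c \<odot>\<^bsub>V\<^esub> x) = c \<odot>\<^bsub>W\<^esub> f x)"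

text \<open>As usual for function spaces with explicit carriers, the elements of a set of
  homomorphisms are taken extensional, so that equality is equality on the carrier.\<close>

definition linear_dual :: "(bit, 'a) module \<Rightarrow> ('a \<Rightarrow> bit) set"
  where "linear_dual V = {f \<in> extensional (carrier V). linear_map V F2_space f}"

definition subspace_span :: "(bit, 'a) module \<Rightarrow> 'a set \<Rightarrow> 'a set"
  where "subspace_span V S = \<Inter>{W. submodule W F2 V \<and> S \<subseteq> W}"

definition quotient_space :: "(bit, 'a) module \<Rightarrow> 'a set \<Rightarrow> (bit, 'a set) module"
  where "quotient_space V W =
    vsp (a_rcosets\<^bsub>V\<^esub> W) W (set_add V) (\<lambda>c C. \<Union>x\<in>C. W +>\<^bsub>V\<^esub> (c \<odot>\<^bsub>V\<^esub> x))"

section \<open>Unstable modules over the Steenrod algebra\<close>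

text \<open>
  Graded objects are families of \<open>F\<^sub>2\<close>-vector spaces indexed by the natural numbers (unstable
  modules vanish in negative degrees because \<open>Sq\<^sup>0\<close> is the identity); only homogeneous
  elements are considered.  \<open>Sq M i n\<close> is the operation \<open>Sq\<^sup>i\<close> from \<open>M\<^sup>n\<close> to \<open>M\<^sup>n\<^sup>+\<^sup>i\<close>.  As the
  Steenrod algebra is presented by the generators \<open>Sq\<^sup>i\<close> subject to \<open>Sq\<^sup>0 = 1\<close> and the Adem
  relations, a module over it is a graded vector space with operations satisfying these
  relations.
\<close>

record 'a gmod =
  piece :: "nat \<Rightarrow> (bit, 'a) module"
  Sq :: "nat \<Rightarrow> nat \<Rightarrow> 'a \<Rightarrow> 'a"

definition steenrod_module :: "('a, 'z) gmod_scheme \<Rightarrow> bool"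
  where "steenrod_module M \<longleftrightarrow>
    (\<forall>n. module F2 (piece M n)) \<and>
    (\<forall>i n. linear_map (piece M n) (piece M (n + i)) (Sq M i n)) \<and>
    (\<forall>n. \<forall>x\<in>carrier (piece M n). Sq M 0 n x = x) \<and>
    (\<forall>a b n. \<forall>x\<in>carrier (piece M n). 0 < a \<and> a < 2 * b \<longrightarrow>
      Sq M a (n + b) (Sq M b n x) =
        (\<Oplus>\<^bsub>piece M (n + a + b)\<^esub> c\<in>{..a div 2}.
          of_nat ((b - c - 1) choose (a - 2 * c))
            \<odot>\<^bsub>piece M (n + a + b)\<^esub> Sq M (a + b - c) (n + c) (Sq M c n x)))"

definition unstable_module :: "('a, 'z) gmod_scheme \<Rightarrow> bool"
  where "unstable_module M \<longleftrightarrow> steenrod_module M \<and>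
    (\<forall>i n. \<forall>x\<in>carrier (piece M n). n < i \<longrightarrow> Sq M i n x = \<zero>\<^bsub>piece M (n + i)\<^esub>)"

definition A_map :: "('a, 'y) gmod_scheme \<Rightarrow> ('b, 'z) gmod_scheme \<Rightarrow> (nat \<Rightarrow> 'a \<Rightarrow> 'b) \<Rightarrow> bool"
  where "A_map M N f \<longleftrightarrow>
    (\<forall>n. linear_map (piece M n) (piece N n) (f n)) \<and>
    (\<forall>i n. \<forall>x\<in>carrier (piece M n). f (n + i) (Sq M i n x) = Sq N i n (f n x))"

definition A_Hom :: "('a, 'y) gmod_scheme \<Rightarrow> ('b, 'z) gmod_scheme \<Rightarrow> (nat \<Rightarrow> 'a \<Rightarrow> 'b) set"
  where "A_Hom M N = {f. A_map M N f \<and> (\<forall>n. f n \<in> extensional (carrier (piece M n)))}"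

definition A_isomorphic :: "('a, 'y) gmod_scheme \<Rightarrow> ('b, 'z) gmod_scheme \<Rightarrow> bool"
  where "A_isomorphic M N \<longleftrightarrow>
    (\<exists>f. A_map M N f \<and> (\<forall>n. bij_betw (f n) (carrier (piece M n)) (carrier (piece N n))))"

text \<open>
  The category of unstable modules over which the universal property ranges consists of the
  unstable modules whose homogeneous components have carriers in the type \<open>'a\<close> of the
  Brown-Gitler module itself; the type \<open>'a\<close> plays the role of the universe.  For infinite \<open>'a\<close>
  this category contains, up to isomorphism, all countable unstable modules, in particular the
  free ones on one generator, and the property then determines \<open>J\<close> up to isomorphism.  For
  finite \<open>'a\<close> it can be degenerate (for instance if \<open>'a\<close> has a single element), so this
  definition is meant to be used at infinite types only.
\<close>

definition brown_gitler :: "nat \<Rightarrow> 'a gmod \<Rightarrow> bool"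
  where "brown_gitler n J \<longleftrightarrow> unstable_module J \<and>
    (\<exists>\<phi> :: 'a gmod \<Rightarrow> (nat \<Rightarrow> 'a \<Rightarrow> 'a) \<Rightarrow> ('a \<Rightarrow> bit).
      (\<forall>M. unstable_module M \<longrightarrow> bij_betw (\<phi> M) (A_Hom M J) (linear_dual (piece M n))) \<and>
      (\<forall>M M'. unstable_module M \<and> unstable_module M' \<longrightarrow>
        (\<forall>g\<in>A_Hom M' M. \<forall>f\<in>A_Hom M J.
          \<phi> M' (\<lambda>k. compose (carrier (piece M' k)) (f k) (g k)) =
            compose (carrier (piece M' n)) (\<phi> M f) (g n))))"

section \<open>Unstable \<open>H\<close>-\<open>A\<close>-modules\<close>

text \<open>\<open>act E i n h x\<close> is the product of \<open>h \<in> H\<^sup>i\<close> and \<open>x \<in> E\<^sup>n\<close>.\<close>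

record 'a hmod = "'a gmod" +
  act :: "nat \<Rightarrow> nat \<Rightarrow> bit poly \<Rightarrow> 'a \<Rightarrow> 'a"

abbreviation tt :: "bit poly"
  where "tt \<equiv> [:0, 1:]"

text \<open>\<open>HH\<close> is the algebra \<open>H = F\<^sub>2[t]\<close>, with \<open>Sq\<^sup>k t\<^sup>n = (n choose k) t\<^sup>n\<^sup>+\<^sup>k\<close>, acting on itself.\<close>

definition HH :: "bit poly hmod"
  where "HH =
    \<lparr>piece = (\<lambda>n. vsp {Polynomial.smult c (tt ^ n) | c. True} 0 (+) Polynomial.smult),
     Sq = (\<lambda>k n p. of_nat (n choose k) * tt ^ k * p),
     act = (\<lambda>i n h p. h * p)\<rparr>"

text \<open>The last clause says that the action map \<open>H \<otimes> E \<rightarrow> E\<close> commutes with the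
  (diagonal) Steenrod operations, tested on the elements \<open>h \<otimes> x\<close>.\<close>

definition unstable_HA_module :: "('a, 'z) hmod_scheme \<Rightarrow> bool"
  where "unstable_HA_module E \<longleftrightarrow> unstable_module E \<and>
    (\<forall>i n. \<forall>h\<in>carrier (piece HH i). linear_map (piece E n) (piece E (i + n)) (act E i n h)) \<and>
    (\<forall>i n. \<forall>x\<in>carrier (piece E n). linear_map (piece HH i) (piece E (i + n)) (\<lambda>h. act E i n h x)) \<and>
    (\<forall>n. \<forall>x\<in>carrier (piece E n). act E 0 n 1 x = x) \<and>
    (\<forall>i j n. \<forall>h\<in>carrier (piece HH i). \<forall>k\<in>carrier (piece HH j). \<forall>x\<in>carrier (piece E n).
      act E (i + j) n (h * k) x = act E i (j + n) h (act E j n k x)) \<and>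
    (\<forall>k i n. \<forall>h\<in>carrier (piece HH i). \<forall>x\<in>carrier (piece E n).
      Sq E k (i + n) (act E i n h x) =
        (\<Oplus>\<^bsub>piece E (i + n + k)\<^esub> a\<in>{..k}.
          act E (i + a) (n + (k - a)) (Sq HH a i h) (Sq E (k - a) n x)))"

definition HA_map :: "('a, 'y) hmod_scheme \<Rightarrow> ('b, 'z) hmod_scheme \<Rightarrow> (nat \<Rightarrow> 'a \<Rightarrow> 'b) \<Rightarrow> bool"
  where "HA_map E F f \<longleftrightarrow> A_map E F f \<and>
    (\<forall>i n. \<forall>h\<in>carrier (piece HH i). \<forall>x\<in>carrier (piece E n).
      f (i + n) (act E i n h x) = act F i n h (f n x))"

definition HA_isomorphic :: "('a, 'y) hmod_scheme \<Rightarrow> ('b, 'z) hmod_scheme \<Rightarrow> bool"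
  where "HA_isomorphic E F \<longleftrightarrow>
    (\<exists>f. HA_map E F f \<and> (\<forall>n. bij_betw (f n) (carrier (piece E n)) (carrier (piece F n))))"

text \<open>Existence of a basis consisting of homogeneous elements; the pair \<open>(d, b)\<close> stands for the
  basis element \<open>b\<close> in degree \<open>d\<close>, and \<open>c\<close> is the finitely supported family of
  homogeneous coefficients of \<open>x\<close>.\<close>

definition free_H_module :: "('a, 'z) hmod_scheme \<Rightarrow> bool"
  where "free_H_module E \<longleftrightarrow>
    (\<exists>B :: (nat \<times> 'a) set.
      (\<forall>(d, b)\<in>B. b \<in> carrier (piece E d)) \<and>
      (\<forall>n. \<forall>x\<in>carrier (piece E n).
        \<exists>!c :: (nat \<times> 'a) \<Rightarrow>\<^sub>0 bit poly.
          (\<forall>(d, b)\<in>Poly_Mapping.keys c.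
            (d, b) \<in> B \<and> d \<le> n \<and> Poly_Mapping.lookup c (d, b) \<in> carrier (piece HH (n - d))) \<and>
          x = (\<Oplus>\<^bsub>piece E n\<^esub> e\<in>Poly_Mapping.keys c.
                act E (n - fst e) (fst e) (Poly_Mapping.lookup c e) (snd e))))"

text \<open>For \<open>N\<close> a family of subspaces stable under the Steenrod operations and the action of \<open>H\<close>,
  the following unions of cosets are single cosets.\<close>

definition quotient_hmod :: "'a hmod \<Rightarrow> (nat \<Rightarrow> 'a set) \<Rightarrow> 'a set hmod"
  where "quotient_hmod E N =
    \<lparr>piece = (\<lambda>n. quotient_space (piece E n) (N n)),
     Sq = (\<lambda>k n C. \<Union>x\<in>C. N (n + k) +>\<^bsub>piece E (n + k)\<^esub> Sq E k n x),
     act = (\<lambda>i n h C. \<Union>x\<in>C. N (i + n) +>\<^bsub>piece E (i + n)\<^esub> act E i n h x)\<rparr>"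

definition augmentation_part :: "('a, 'z) hmod_scheme \<Rightarrow> nat \<Rightarrow> 'a set"
  where "augmentation_part E n = subspace_span (piece E n)
    {act E i j h x | i j h x.
      0 < i \<and> i + j = n \<and> h \<in> carrier (piece HH i) \<and> x \<in> carrier (piece E j)}"

definition reduction :: "'a hmod \<Rightarrow> 'a set hmod"
  where "reduction E = quotient_hmod E (augmentation_part E)"

section \<open>Tensor products, suspensions, direct sums, generated submodules\<close>

text \<open>The tensor product over \<open>F\<^sub>2\<close> is the quotient of the free vector space on the
  triples \<open>(i, x, y)\<close> (representing \<open>x \<otimes> y\<close> with \<open>x\<close> in degree \<open>i\<close>) by the
  bilinearity relations.  The operations are first defined on the free vector space.\<close>

definition pre_tensor :: "'a hmod \<Rightarrow> ('b, 'z) gmod_scheme \<Rightarrow> ((nat \<times> 'a \<times> 'b) \<Rightarrow>\<^sub>0 bit) hmod"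
  where "pre_tensor L M =
    \<lparr>piece = (\<lambda>n. vsp
       {p. \<forall>(i, x, y)\<in>Poly_Mapping.keys p.
          i \<le> n \<and> x \<in> carrier (piece L i) \<and> y \<in> carrier (piece M (n - i))}
       0 (+) (\<lambda>c. Poly_Mapping.map ((*) c))),
     Sq = (\<lambda>k n p. \<Sum>(i, x, y)\<in>Poly_Mapping.keys p. \<Sum>a\<in>{..k}.
       Poly_Mapping.single (i + a, Sq L a i x, Sq M (k - a) (n - i) y)
         (Poly_Mapping.lookup p (i, x, y))),
     act = (\<lambda>j n h p. \<Sum>(i, x, y)\<in>Poly_Mapping.keys p.
       Poly_Mapping.single (j + i, act L j i h x, y) (Poly_Mapping.lookup p (i, x, y)))\<rparr>"

definition bilinearity_relations ::
    "('a, 'y) hmod_scheme \<Rightarrow> ('b, 'z) gmod_scheme \<Rightarrow> nat \<Rightarrow> ((nat \<times> 'a \<times> 'b) \<Rightarrow>\<^sub>0 bit) set"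
  where "bilinearity_relations L M n =
    (let e = (\<lambda>i x y. Poly_Mapping.single (i, x, y) (1 :: bit)) in
      (\<Union>i\<le>n. \<Union>x\<in>carrier (piece L i). \<Union>y\<in>carrier (piece M (n - i)).
        {e i (x \<oplus>\<^bsub>piece L i\<^esub> x') y - e i x y - e i x' y | x'. x' \<in> carrier (piece L i)} \<union>
        {e i x (y \<oplus>\<^bsub>piece M (n - i)\<^esub> y') - e i x y - e i x y' | y'. y' \<in> carrier (piece M (n - i))} \<union>
        {e i (c \<odot>\<^bsub>piece L i\<^esub> x) y - Poly_Mapping.map ((*) c) (e i x y) | c. True} \<union>
        {e i x (c \<odot>\<^bsub>piece M (n - i)\<^esub> y) - Poly_Mapping.map ((*) c) (e i x y) | c. True}))"

definition tensor :: "'a hmod \<Rightarrow> ('b, 'z) gmod_scheme \<Rightarrow> ((nat \<times> 'a \<times> 'b) \<Rightarrow>\<^sub>0 bit) set hmod"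
  where "tensor L M = quotient_hmod (pre_tensor L M)
    (\<lambda>n. subspace_span (piece (pre_tensor L M) n) (bilinearity_relations L M n))"

text \<open>The element \<open>\<Sigma>x\<close> of degree \<open>n + 1\<close> is represented by \<open>x\<close> itself.\<close>

definition suspension_piece :: "('a, 'z) gmod_scheme \<Rightarrow> nat \<Rightarrow> (bit, 'a) module"
  where "suspension_piece N n =
    (case n of 0 \<Rightarrow> (piece N 0)\<lparr>carrier := {\<zero>\<^bsub>piece N 0\<^esub>}\<rparr> | Suc m \<Rightarrow> piece N m)"

definition suspension :: "'a hmod \<Rightarrow> 'a hmod"
  where "suspension N =
    \<lparr>piece = suspension_piece N,
     Sq = (\<lambda>k n x. case n of 0 \<Rightarrow> \<zero>\<^bsub>suspension_piece N k\<^esub> | Suc m \<Rightarrow> Sq N k m x),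
     act = (\<lambda>i n h x. case n of 0 \<Rightarrow> \<zero>\<^bsub>suspension_piece N i\<^esub> | Suc m \<Rightarrow> act N i m h x)\<rparr>"

definition direct_sum :: "'a hmod \<Rightarrow> 'b hmod \<Rightarrow> ('a \<times> 'b) hmod"
  where "direct_sum M N =
    \<lparr>piece = (\<lambda>n. vsp
       (carrier (piece M n) \<times> carrier (piece N n))
       (\<zero>\<^bsub>piece M n\<^esub>, \<zero>\<^bsub>piece N n\<^esub>)
       (\<lambda>(x, y) (x', y'). (x \<oplus>\<^bsub>piece M n\<^esub> x', y \<oplus>\<^bsub>piece N n\<^esub> y'))
       (\<lambda>c (x, y). (c \<odot>\<^bsub>piece M n\<^esub> x, c \<odot>\<^bsub>piece N n\<^esub> y))),
     Sq = (\<lambda>k n (x, y). (Sq M k n x, Sq N k n y)),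
     act = (\<lambda>i n h (x, y). (act M i n h x, act N i n h y))\<rparr>"

definition sub_HA_module :: "(nat \<Rightarrow> 'a set) \<Rightarrow> ('a, 'z) hmod_scheme \<Rightarrow> bool"
  where "sub_HA_module S E \<longleftrightarrow>
    (\<forall>n. submodule (S n) F2 (piece E n)) \<and>
    (\<forall>k n. \<forall>x\<in>S n. Sq E k n x \<in> S (n + k)) \<and>
    (\<forall>i n. \<forall>h\<in>carrier (piece HH i). \<forall>x\<in>S n. act E i n h x \<in> S (i + n))"

text \<open>A set of generators is a set of pairs \<open>(d, x)\<close> with \<open>x\<close> an element of degree \<open>d\<close>.\<close>

definition generated_HA_submodule :: "'a hmod \<Rightarrow> (nat \<times> 'a) set \<Rightarrow> 'a hmod"
  where "generated_HA_submodule E G =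
    E\<lparr>piece := (\<lambda>n. (piece E n)
       \<lparr>carrier := \<Inter>{S n | S. sub_HA_module S E \<and> (\<forall>(d, x)\<in>G. x \<in> S d)}\<rparr>)\<rparr>"

end

theory Submission
  imports Defs "HOL-Library.Product_Plus"
begin

text \<open>
  Testing the universal property on \<open>\<Sigma>\<^sup>2F\<^sub>2\<close>, on \<open>J(2)\<close> itself and on a submodule of \<open>J\<close> with trivial
  degree 2 shows that \<open>J(2)\<close> has basis \<open>a, Sq\<^sup>1 a\<close> in degrees 1 and 2.  Freeness is only used to
  know that \<open>t\<close> acts injectively on \<open>E\<close>; since the augmentation part in degree \<open>n + 1\<close> is \<open>t E\<^sup>n\<close>,
  \<open>E\<close> is free on a lift \<open>x\<close> of \<open>a\<close> and on \<open>y = Sq\<^sup>1 x\<close>.  By the Cartan formula the Steenrod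
  operations on \<open>E\<close> are determined by those on \<open>x\<close> and \<open>y\<close>.  Here \<open>Sq\<^sup>1 y = Sq\<^sup>1 Sq\<^sup>1 x = 0\<close>, and
  \<open>Sq\<^sup>1 Sq\<^sup>2 y = Sq\<^sup>3 y = 0\<close> by instability, which forces \<open>Sq\<^sup>2 y = \<beta> t\<^sup>2 y\<close>.  The case \<open>\<beta> = 0\<close> is
  \<open>H \<otimes> J(2)\<close>; for \<open>\<beta> = 1\<close> the assignment \<open>x \<mapsto> (t, \<Sigma>1)\<close>, \<open>y \<mapsto> (t\<^sup>2, 0)\<close> embeds \<open>E\<close> into
  \<open>H \<oplus> \<Sigma>H\<close>.
\<close>

section \<open>Vector spaces over \<open>F\<^sub>2\<close>\<close>

text \<open>\<open>E\<close> and both candidates are compared with one concrete family,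
  \<open>model \<beta>\<close>, always by bijective maps out of the model; an isomorphism from
  \<open>E\<close> to a candidate is then one such map after the inverse of another. This reduces
  the classification to coordinates: which squares a pair of bits has in degree n. The two values of
  \<open>\<beta>\<close> are read off from the candidates. In H \<oplus> \<Sigma>H the class (t^2,
  0) has Sq^2 equal to (t^4, 0), that is t^2 times itself, whereas Sq^2(1 \<otimes> Sq^1 a) = 1
  \<otimes> Sq^2 Sq^1 a vanishes because J(2) is zero in degree 4. The universal property speaks
  only of modules with carriers in the type of \<open>J\<close>. The test modules are therefore
  built from two elements of that infinite type or cut out of \<open>J\<close>, and the property
  acts through the sizes of Hom sets.\<close>

lemma F2_simps [simp]:
  "carrier F2 = UNIV" "a \<oplus>\<^bsub>F2\<^esub> b = a + b" "a \<otimes>\<^bsub>F2\<^esub> b = a * b" "\<zero>\<^bsub>F2\<^esub> = 0" "\<one>\<^bsub>F2\<^esub> = 1"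
  by (simp_all add: ring_of_type_algebra_def)

lemma vsp_simps [simp]:
  "carrier (vsp C z a s) = C" "x \<oplus>\<^bsub>vsp C z a s\<^esub> y = a x y" "\<zero>\<^bsub>vsp C z a s\<^esub> = z"
  "c \<odot>\<^bsub>vsp C z a s\<^esub> x = s c x" "add (vsp C z a s) = a"
  by (simp_all add: vsp_def)

locale F2_module = module F2 V for V :: "(bit, 'a) module" (structure)

lemma F2_moduleI [intro]: "module F2 V \<Longrightarrow> F2_module V"
  by (simp add: F2_module_def)

context F2_module
begin

lemma smult_bit: "x \<in> carrier V \<Longrightarrow> c \<odot> x = (if c = 0 then \<zero> else x)"
  using smult_l_null smult_one by (cases c) auto

lemma add_self: "x \<in> carrier V \<Longrightarrow> x \<oplus> x = \<zero>"
  using smult_l_distr[of 1 1 x] smult_l_null smult_one by simp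

lemma minus_self: "x \<in> carrier V \<Longrightarrow> \<ominus> x = x"
  using add_self M.minus_equality by blast

lemma add_eq_zero_iff: "x \<in> carrier V \<Longrightarrow> y \<in> carrier V \<Longrightarrow> x \<oplus> y = \<zero> \<longleftrightarrow> x = y"
  using add_self M.minus_equality minus_self by metis

lemma finsum_singleton: "f a \<in> carrier V \<Longrightarrow> finsum V f {a} = f a"
  by simp

lemma submoduleI_F2:
  assumes "H \<subseteq> carrier V" "\<zero> \<in> H" "\<And>a b. a \<in> H \<Longrightarrow> b \<in> H \<Longrightarrow> a \<oplus> b \<in> H"
  shows "submodule H F2 V"
  using assms by (intro submoduleI) (auto simp: minus_self smult_bit subset_iff)

end

text \<open>With only the scalars 0 and 1, every scalar axiom is a finite case check;
  \<open>x \<oplus> x = \<zero>\<close> supplies the additive inverses and also the instance 1 + 1 =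
  0 of distributivity.\<close>

lemma F2_moduleI_carrier:
  fixes V (structure)
  assumes "\<And>x y. x \<in> carrier V \<Longrightarrow> y \<in> carrier V \<Longrightarrow> x \<oplus> y \<in> carrier V" "\<zero> \<in> carrier V"
    "\<And>x y z. x \<in> carrier V \<Longrightarrow> y \<in> carrier V \<Longrightarrow> z \<in> carrier V \<Longrightarrow> (x \<oplus> y) \<oplus> z = x \<oplus> (y \<oplus> z)"
    "\<And>x y. x \<in> carrier V \<Longrightarrow> y \<in> carrier V \<Longrightarrow> x \<oplus> y = y \<oplus> x"
    "\<And>x. x \<in> carrier V \<Longrightarrow> \<zero> \<oplus> x = x" "\<And>x. x \<in> carrier V \<Longrightarrow> x \<oplus> x = \<zero>"
    "\<And>x. x \<in> carrier V \<Longrightarrow> 0 \<odot> x = \<zero>" "\<And>x. x \<in> carrier V \<Longrightarrow> 1 \<odot> x = x"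
  shows "module F2 V"
proof (rule moduleI)
  show "cring F2"
    by (rule cring_from_type_algebra)
  show "abelian_group V"
    using assms(1-6) by (intro abelian_groupI) (assumption | blast)+
  have r0: "x \<oplus> \<zero> = x" if "x \<in> carrier V" for x
    using assms(2,4,5) that by metis
  fix a b :: bit and x y
  assume "x \<in> carrier V"
  then show "a \<odot> x \<in> carrier V" "(a \<oplus>\<^bsub>F2\<^esub> b) \<odot> x = a \<odot> x \<oplus> b \<odot> x"
    "(a \<otimes>\<^bsub>F2\<^esub> b) \<odot> x = a \<odot> (b \<odot> x)" "\<one>\<^bsub>F2\<^esub> \<odot> x = x"
    using assms r0 by (cases a; cases b; simp)+
  assume "y \<in> carrier V"
  with \<open>x \<in> carrier V\<close> show "a \<odot> (x \<oplus> y) = a \<odot> x \<oplus> a \<odot> y"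
    using assms r0 by (cases a; simp)
qed

lemma module_F2_space: "module F2 F2_space"
proof -
  have "x + x = 0" for x :: bit
    by (cases x) auto
  then show ?thesis
    by (intro F2_moduleI_carrier) (auto simp: F2_space_def)
qed

text \<open>An additive map between spaces of characteristic 2 has f(0) = f(0) + f(0) = 0, which
  settles the scalar 0; the scalar 1 is immediate.\<close>

lemma linear_map_iff:
  assumes "module F2 V" "module F2 W"
  shows "linear_map V W f \<longleftrightarrow> (\<forall>x\<in>carrier V. f x \<in> carrier W) \<and>
    (\<forall>x\<in>carrier V. \<forall>y\<in>carrier V. f (x \<oplus>\<^bsub>V\<^esub> y) = f x \<oplus>\<^bsub>W\<^esub> f y)" (is "_ \<longleftrightarrow> ?R")
proof -
  interpret V: F2_module V using assms by blast
  interpret W: F2_module W using assms by blast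
  have "f (c \<odot>\<^bsub>V\<^esub> x) = c \<odot>\<^bsub>W\<^esub> f x" if *: ?R and x: "x \<in> carrier V" for c x
  proof -
    have "f \<zero>\<^bsub>V\<^esub> \<oplus>\<^bsub>W\<^esub> f \<zero>\<^bsub>V\<^esub> = f (\<zero>\<^bsub>V\<^esub> \<oplus>\<^bsub>V\<^esub> \<zero>\<^bsub>V\<^esub>)"
      using * V.M.zero_closed by metis
    then have "f \<zero>\<^bsub>V\<^esub> = \<zero>\<^bsub>W\<^esub>"
      using * W.add_self by auto
    then show ?thesis
      using * x by (simp add: V.smult_bit W.smult_bit)
  qed
  then show ?thesis
    unfolding linear_map_def hom_def by auto
qed

lemma linear_map_closed: "linear_map V W f \<Longrightarrow> x \<in> carrier V \<Longrightarrow> f x \<in> carrier W"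
  by (auto simp: linear_map_def hom_def)

lemma linear_map_add:
  "linear_map V W f \<Longrightarrow> x \<in> carrier V \<Longrightarrow> y \<in> carrier V \<Longrightarrow> f (x \<oplus>\<^bsub>V\<^esub> y) = f x \<oplus>\<^bsub>W\<^esub> f y"
  by (auto simp: linear_map_def hom_def)

lemma linear_map_smult: "linear_map V W f \<Longrightarrow> x \<in> carrier V \<Longrightarrow> f (c \<odot>\<^bsub>V\<^esub> x) = c \<odot>\<^bsub>W\<^esub> f x"
  by (auto simp: linear_map_def)

lemma linear_map_zero:
  assumes "module F2 V" "module F2 W" "linear_map V W f"
  shows "f \<zero>\<^bsub>V\<^esub> = \<zero>\<^bsub>W\<^esub>"
proof -
  interpret V: F2_module V using assms by blast
  interpret W: F2_module W using assms by blast
  show ?thesis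
    using linear_map_smult[OF assms(3) V.M.zero_closed, of 0]
      linear_map_closed[OF assms(3) V.M.zero_closed] by (simp add: V.smult_bit W.smult_bit)
qed

lemma linear_map_inj_on:
  assumes "module F2 V" "module F2 W" "linear_map V W f"
    and "\<And>x. x \<in> carrier V \<Longrightarrow> f x = \<zero>\<^bsub>W\<^esub> \<Longrightarrow> x = \<zero>\<^bsub>V\<^esub>"
  shows "inj_on f (carrier V)"
proof (rule inj_onI)
  interpret V: F2_module V using assms by blast
  interpret W: F2_module W using assms by blast
  fix x y assume *: "x \<in> carrier V" "y \<in> carrier V" "f x = f y"
  then have "f (x \<oplus>\<^bsub>V\<^esub> y) = \<zero>\<^bsub>W\<^esub>"
    using assms(3) W.add_self by (simp add: linear_map_add linear_map_closed)
  then show "x = y"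
    using assms(4)[of "x \<oplus>\<^bsub>V\<^esub> y"] * V.add_eq_zero_iff by simp
qed

lemma linear_map_finsum:
  assumes "module F2 V" "module F2 W" "linear_map V W f" "finite A" "g \<in> A \<rightarrow> carrier V"
  shows "f (finsum V g A) = finsum W (f \<circ> g) A"
proof -
  interpret V: F2_module V using assms by blast
  interpret W: F2_module W using assms by blast
  show ?thesis
    using assms(4,5)
  proof induction
    case empty
    then show ?case
      using assms by (simp add: linear_map_zero)
  next
    case (insert x A)
    then have "g x \<in> carrier V" "g \<in> A \<rightarrow> carrier V" "(f \<circ> g) \<in> A \<rightarrow> carrier W"
        using linear_map_closed[OF assms(3)] by (auto simp: Pi_iff)
    with insert show ?case
      using linear_map_closed[OF assms(3)] by (simp add: linear_map_add[OF assms(3)] comp_def Pi_iff)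
  qed
qed

text \<open>\<open>finsum\<close> consults the carrier of its module, so shrinking the carrier
  changes the term and agreement has to be proved by induction. This transfers the Adem sums to
  submodules.\<close>

lemma finsum_carrier_update:
  fixes V :: "(bit, 'a) module"
  assumes "module F2 V" "submodule N F2 V" "finite A" "g \<in> A \<rightarrow> N"
  shows "finsum (V\<lparr>carrier := N\<rparr>) g A = finsum V g A"
proof -
  interpret V: F2_module V using assms by blast
  interpret W: F2_module "V\<lparr>carrier := N\<rparr>"
    using submodule.submodule_is_module assms by blast
  have N: "N \<subseteq> carrier V"
    using V.submoduleE assms by blast
  show ?thesis
    using assms(3,4)
  proof induction
    case empty
    then show ?case by simp
  next
    case (insert x A)
    then have "g \<in> A \<rightarrow> carrier V" "g x \<in> carrier V" "g \<in> A \<rightarrow> N" "g x \<in> N"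
      using N by auto
    then show ?case
      using insert by simp
  qed
qed

lemma subspace_span_submodule:
  assumes "module F2 V" "S \<subseteq> carrier V"
  shows "submodule (subspace_span V S) F2 V"
proof -
  interpret F2_module V using assms by blast
  \<comment> \<open>The carrier belongs to the intersected family, which keeps the intersection
    inside it.\<close>
  have c: "submodule (carrier V) F2 V"
    by (rule carrier_is_submodule)
  have "\<zero>\<^bsub>V\<^esub> \<in> W" if "submodule W F2 V" for W
    using that subgroup.one_closed[OF submodule.axioms(1)] by fastforce
  then show ?thesis
    unfolding subspace_span_def using assms c submoduleE(5) by (intro submoduleI_F2) auto
qed

lemma subspace_span_superset: "S \<subseteq> subspace_span V S"
  by (auto simp: subspace_span_def)

lemma subspace_span_least: "submodule W F2 V \<Longrightarrow> S \<subseteq> W \<Longrightarrow> subspace_span V S \<subseteq> W"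
  by (auto simp: subspace_span_def)

lemma submodule_zero: "submodule W F2 V \<Longrightarrow> \<zero>\<^bsub>V\<^esub> \<in> W"
  using subgroup.one_closed[OF submodule.axioms(1)] by fastforce

section \<open>Unstable modules\<close>

lemma unstable_moduleD:
  assumes "unstable_module M"
  shows "module F2 (piece M n)" "linear_map (piece M n) (piece M (n + i)) (Sq M i n)"
    "x \<in> carrier (piece M n) \<Longrightarrow> Sq M 0 n x = x"
    "x \<in> carrier (piece M n) \<Longrightarrow> n < i \<Longrightarrow> Sq M i n x = \<zero>\<^bsub>piece M (n + i)\<^esub>"
    "x \<in> carrier (piece M n) \<Longrightarrow> Sq M i n x \<in> carrier (piece M (n + i))"
  using assms unfolding unstable_module_def steenrod_module_def by (auto dest: linear_map_closed)

lemma unstable_module_adem: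
  assumes "unstable_module M" "x \<in> carrier (piece M n)" "0 < a" "a < 2 * b"
  shows "Sq M a (n + b) (Sq M b n x) =
        (\<Oplus>\<^bsub>piece M (n + a + b)\<^esub> c\<in>{..a div 2}.
          of_nat ((b - c - 1) choose (a - 2 * c))
            \<odot>\<^bsub>piece M (n + a + b)\<^esub> Sq M (a + b - c) (n + c) (Sq M c n x))"
  using assms unfolding unstable_module_def steenrod_module_def by blast

text \<open>Supplies the test modules cut out of a given module. The delicate point is the Adem
  relation, whose sum is now formed in the smaller carrier.\<close>

lemma unstable_module_restrict:
  fixes M :: "'a gmod"
  assumes M: "unstable_module M" and N: "\<And>n. submodule (N n) F2 (piece M n)"
    and Sq: "\<And>i n x. x \<in> N n \<Longrightarrow> Sq M i n x \<in> N (n + i)"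
  shows "unstable_module (M\<lparr>piece := \<lambda>n. (piece M n)\<lparr>carrier := N n\<rparr>\<rparr>)"
proof -
  note D = unstable_moduleD[OF M]
  have sub: "x \<in> carrier (piece M n)" if "x \<in> N n" for x n
    using module.submoduleE(1)[OF D(1) N] that by auto
  have mod: "module F2 ((piece M n)\<lparr>carrier := N n\<rparr>)" for n
    by (rule submodule.submodule_is_module[OF N D(1)])
  have adem: "Sq M a (n + b) (Sq M b n x) =
      (\<Oplus>\<^bsub>(piece M (n + a + b))\<lparr>carrier := N (n + a + b)\<rparr>\<^esub> c\<in>{..a div 2}.
          of_nat ((b - c - 1) choose (a - 2 * c))
            \<odot>\<^bsub>piece M (n + a + b)\<^esub> Sq M (a + b - c) (n + c) (Sq M c n x))"
    if "x \<in> N n" "0 < a" "a < 2 * b" for a b n x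
  proof -
    have "of_nat ((b - c - 1) choose (a - 2 * c))
            \<odot>\<^bsub>piece M (n + a + b)\<^esub> Sq M (a + b - c) (n + c) (Sq M c n x) \<in> N (n + a + b)"
      if "c \<le> a div 2" for c
    proof -
      \<comment> \<open>The subtraction truncates, so landing in degree n + a + b depends on c \<le>
        a div 2.\<close>
      have "(n + c) + (a + b - c) = n + a + b"
        using that by auto
      then have "Sq M (a + b - c) (n + c) (Sq M c n x) \<in> N (n + a + b)"
        using Sq \<open>x \<in> N n\<close> by metis
      then show ?thesis
        using module.submoduleE(4)[OF D(1) N] by simp
    qed
    then show ?thesis
      using unstable_module_adem[OF M sub[OF that(1)] that(2,3)]
      by (subst finsum_carrier_update[OF D(1) N]) auto
  qed
  show ?thesis
    unfolding unstable_module_def steenrod_module_def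
    using mod adem sub D Sq by (auto simp: linear_map_iff linear_map_add[OF D(2)])
qed

section \<open>The Brown-Gitler module \<open>J(2)\<close>\<close>

lemma A_HomD:
  assumes "f \<in> A_Hom M N"
  shows "linear_map (piece M n) (piece N n) (f n)"
    "x \<in> carrier (piece M n) \<Longrightarrow> f (n + i) (Sq M i n x) = Sq N i n (f n x)"
    "f n \<in> extensional (carrier (piece M n))"
  using assms by (auto simp: A_Hom_def A_map_def)

lemma linear_dualD:
  assumes "f \<in> linear_dual V"
  shows "linear_map V F2_space f" "f \<in> extensional (carrier V)"
  using assms by (auto simp: linear_dual_def)

lemma brown_gitlerD:
  fixes J :: "'u gmod"
  assumes "brown_gitler n J"
  shows "unstable_module J"
    "\<And>M :: 'u gmod. unstable_module M \<Longrightarrow> \<exists>\<phi>. bij_betw \<phi> (A_Hom M J) (linear_dual (piece M n))"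
  using assms unfolding brown_gitler_def by blast+

text \<open>If \<open>N\<close> vanishes in degree \<open>d\<close>, the dual of its degree
  \<open>d\<close> part has one element. Hence Hom(N, J) has one element, and the inclusion of
  \<open>N\<close> equals the zero map.\<close>

lemma brown_gitler_submodule_trivial:
  assumes J: "brown_gitler d J" and N: "\<And>n. submodule (N n) F2 (piece J n)"
    and Sq: "\<And>i n x. x \<in> N n \<Longrightarrow> Sq J i n x \<in> N (n + i)"
    and d: "N d = {\<zero>\<^bsub>piece J d\<^esub>}"
  shows "N n = {\<zero>\<^bsub>piece J n\<^esub>}"
proof -
  note U = brown_gitlerD(1)[OF J]
  note D = unstable_moduleD[OF U]
  define M where "M = J\<lparr>piece := \<lambda>n. (piece J n)\<lparr>carrier := N n\<rparr>\<rparr>"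
  have M: "unstable_module M"
    unfolding M_def by (rule unstable_module_restrict[OF U N Sq])
  have sub: "x \<in> carrier (piece J n)" if "x \<in> N n" for x n
    using module.submoduleE(1)[OF D(1) N] that by auto
  have add: "x \<oplus>\<^bsub>piece J n\<^esub> y \<in> N n" if "x \<in> N n" "y \<in> N n" for x y n
    using module.submoduleE(5)[OF D(1) N] that by auto
  have zero: "Sq J i n \<zero>\<^bsub>piece J n\<^esub> = \<zero>\<^bsub>piece J (n + i)\<^esub>" for i n
    by (rule linear_map_zero[OF D(1) D(1) D(2)])
  obtain \<phi> where \<phi>: "bij_betw \<phi> (A_Hom M J) (linear_dual (piece M d))"
    using brown_gitlerD(2)[OF J M] by blast
  have one: "f = g" if "f \<in> linear_dual (piece M d)" "g \<in> linear_dual (piece M d)" for f g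
  proof (rule extensionalityI[where A = "N d"])
    fix x assume "x \<in> N d"
    then have x: "x = \<zero>\<^bsub>piece M d\<^esub>"
      using d by (simp add: M_def)
    have "h x = \<zero>\<^bsub>F2_space\<^esub>" if "h \<in> linear_dual (piece M d)" for h
      unfolding x by (rule linear_map_zero[OF unstable_moduleD(1)[OF M] module_F2_space linear_dualD(1)[OF that]])
    from this[OF that(1)] this[OF that(2)] show "f x = g x"
      by (rule trans[OF _ sym])
  qed (use that in \<open>auto simp: M_def dest: linear_dualD\<close>)
  \<comment> \<open>The inclusion and the zero map, restricted to be extensional as
    \<open>A_Hom\<close> demands.\<close>
  define f g where "f = (\<lambda>n. restrict (\<lambda>x. x) (N n))"
    and "g = (\<lambda>n. restrict (\<lambda>x. \<zero>\<^bsub>piece J n\<^esub>) (N n))"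
  interpret J: F2_module "piece J k" for k
    using D(1) by blast
  have hom: "f \<in> A_Hom M J" "g \<in> A_Hom M J"
    unfolding A_Hom_def A_map_def
    using unstable_moduleD(1)[OF M] D(1) Sq zero
    by (auto simp: linear_map_iff M_def f_def g_def sub add)
  have "f = g"
    using one[OF bij_betwE[OF \<phi>, rule_format, OF hom(1)] bij_betwE[OF \<phi>, rule_format, OF hom(2)]]
    by (rule inj_onD[OF bij_betw_imp_inj_on[OF \<phi>] _ hom])
  then have "f n x = g n x" for x
    by simp
  then have "\<forall>x\<in>N n. x = \<zero>\<^bsub>piece J n\<^esub>"
    by (metis f_def g_def restrict_apply')
  then have "N n \<subseteq> {\<zero>\<^bsub>piece J n\<^esub>}"
    by (metis singletonI subsetI)
  then show ?thesis
    by (rule subset_antisym) (simp only: singleton_iff insert_subset empty_subsetI submodule_zero[OF N])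
qed

text \<open>For \<open>S = {2}\<close> this is \<open>\<Sigma>\<^sup>2F\<^sub>2\<close>, and for \<open>S = {1, 2}\<close> it is \<open>J(2)\<close> itself.\<close>

definition test_module :: "'u \<Rightarrow> 'u \<Rightarrow> nat set \<Rightarrow> 'u gmod"
  where "test_module z w S =
    \<lparr>piece = (\<lambda>n. vsp (if n \<in> S then {z, w} else {z}) z
       (\<lambda>a b. if a = b then z else w) (\<lambda>c a. if c = 0 then z else a)),
     Sq = (\<lambda>i n x. if i = 0 \<or> i = 1 \<and> n = 1 then x else z)\<rparr>"

text \<open>Two successive positive squares vanish, since the only nonzero one, Sq^1 from degree 1
  to degree 2, cannot be repeated. On the right of an Adem relation the term with c = 0 is Sq^(a+b)
  with a + b \<ge> 2, which is zero too. The assumption \<open>2 \<in> S\<close> gives Sq^1 its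
  target.\<close>

lemma unstable_test_module:
  assumes "z \<noteq> w" "2 \<in> S"
  shows "unstable_module (test_module z w S)"
proof -
  let ?M = "test_module z w S"
  have M: "module F2 (piece ?M n)" for n
    using assms by (intro F2_moduleI_carrier) (auto simp: test_module_def split: if_splits)
  have lin: "linear_map (piece ?M n) (piece ?M (n + i)) (Sq ?M i n)" for i n
    unfolding linear_map_iff[OF M M] using assms by (auto simp: test_module_def numeral_2_eq_2)
  have "Sq ?M a (n + b) (Sq ?M b n x) =
        (\<Oplus>\<^bsub>piece ?M (n + a + b)\<^esub> c\<in>{..a div 2}.
          of_nat ((b - c - 1) choose (a - 2 * c))
            \<odot>\<^bsub>piece ?M (n + a + b)\<^esub> Sq ?M (a + b - c) (n + c) (Sq ?M c n x))"
    if "0 < a" "a < 2 * b" for a b n x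
  proof -
    interpret F2_module "piece ?M (n + a + b)"
      using M by blast
    have "Sq ?M (a + b - c) (n + c) (Sq ?M c n x) = z" if "c \<le> a div 2" for c
      using that \<open>0 < a\<close> \<open>a < 2 * b\<close> by (auto simp: test_module_def)
    then have "(\<Oplus>\<^bsub>piece ?M (n + a + b)\<^esub> c\<in>{..a div 2}.
          of_nat ((b - c - 1) choose (a - 2 * c))
            \<odot>\<^bsub>piece ?M (n + a + b)\<^esub> Sq ?M (a + b - c) (n + c) (Sq ?M c n x)) = z"
      by (subst M.add.finprod_one_eqI) (auto simp: test_module_def)
    moreover have "Sq ?M a (n + b) (Sq ?M b n x) = z"
      using that by (auto simp: test_module_def)
    ultimately show ?thesis
      by simp
  qed
  then show ?thesis
    unfolding unstable_module_def steenrod_module_def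
    using M lin by (auto simp: test_module_def)
qed

text \<open>Degree 2 is one-dimensional, so its dual has exactly two elements. The lower bound will
  force a nonzero class in degree 1 of \<open>J\<close>, the upper bound will limit degree
  2.\<close>

lemma linear_dual_test_module:
  assumes "z \<noteq> w" "2 \<in> S"
  shows "\<exists>f\<in>linear_dual (piece (test_module z w S) 2). \<exists>g\<in>linear_dual (piece (test_module z w S) 2). f \<noteq> g"
    and "inj_on (\<lambda>f. f w) (linear_dual (piece (test_module z w S) 2))"
proof -
  let ?V = "piece (test_module z w S) 2"
  note M = unstable_moduleD(1)[OF unstable_test_module[OF assms]]
  have C: "carrier ?V = {z, w}"
    using assms by (simp add: test_module_def)
  have dual: "f \<in> linear_dual ?V \<longleftrightarrow> f \<in> extensional {z, w} \<and> f z = 0" for f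
    unfolding linear_dual_def linear_map_iff[OF M module_F2_space] C
    using assms by (auto simp: test_module_def F2_space_def)
  have "restrict (\<lambda>_. 0) {z, w} \<in> linear_dual ?V" 
    "restrict (\<lambda>x. if x = z then 0 else 1) {z, w} \<in> linear_dual ?V"
    unfolding dual by auto
  moreover have "restrict (\<lambda>_. 0) {z, w} \<noteq> restrict (\<lambda>x. if x = z then 0 else (1 :: bit)) {z, w}"
    using assms by (auto simp: fun_eq_iff restrict_def)
  ultimately show "\<exists>f\<in>linear_dual ?V. \<exists>g\<in>linear_dual ?V. f \<noteq> g"
    by blast
  show "inj_on (\<lambda>f. f w) (linear_dual ?V)"
    by (rule inj_onI, rule extensionalityI[where A = "{z, w}"]) (auto simp: dual)
qed

text \<open>The largest submodule of \<open>J\<close> that vanishes in degree 2 must be zero, so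
  \<open>J\<close> lives in degrees 1 and 2 and Sq^1 is injective on degree 1. Every element of J^2
  gives a map from the test module concentrated in degree 2, which bounds J^2 by two elements. If
  J^1 were zero, the test module with classes in degrees 1 and 2 would have only the zero map to
  \<open>J\<close>.\<close>

lemma brown_gitler_2_structure:
  fixes J :: "'u gmod"
  assumes inf: "infinite (UNIV :: 'u set)" and J: "brown_gitler 2 J"
  obtains a where "carrier (piece J 0) = {\<zero>\<^bsub>piece J 0\<^esub>}"
    "carrier (piece J 1) = {\<zero>\<^bsub>piece J 1\<^esub>, a}" "a \<noteq> \<zero>\<^bsub>piece J 1\<^esub>"
    "carrier (piece J 2) = {\<zero>\<^bsub>piece J 2\<^esub>, Sq J 1 1 a}" "Sq J 1 1 a \<noteq> \<zero>\<^bsub>piece J 2\<^esub>"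
    "\<And>n. 3 \<le> n \<Longrightarrow> carrier (piece J n) = {\<zero>\<^bsub>piece J n\<^esub>}"
proof -
  note U = brown_gitlerD(1)[OF J]
  note D = unstable_moduleD[OF U]
  interpret J: F2_module "piece J k" for k
    using D(1) by blast
  have zero: "Sq J i n \<zero>\<^bsub>piece J n\<^esub> = \<zero>\<^bsub>piece J (n + i)\<^esub>" for i n
    by (rule linear_map_zero[OF D(1) D(1) D(2)])
  let ?N = "\<lambda>n. {x \<in> carrier (piece J n). (n = 1 \<longrightarrow> Sq J 1 1 x = \<zero>\<^bsub>piece J 2\<^esub>) \<and> (n = 2 \<longrightarrow> x = \<zero>\<^bsub>piece J 2\<^esub>)}"
  have Sq1: "Sq J 1 1 x \<in> carrier (piece J 2)" "Sq J 1 1 (x \<oplus>\<^bsub>piece J 1\<^esub> y) = Sq J 1 1 x \<oplus>\<^bsub>piece J 2\<^esub> Sq J 1 1 y" 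
    if "x \<in> carrier (piece J 1)" "y \<in> carrier (piece J 1)" for x y
    using that D(5)[of x 1 1] linear_map_add[OF D(2)[of 1 1]] by (simp_all add: numeral_2_eq_2)
  have Sq1_zero: "Sq J 1 1 \<zero>\<^bsub>piece J 1\<^esub> = \<zero>\<^bsub>piece J 2\<^esub>"
    using zero[of 1 1] by (simp add: numeral_2_eq_2)
  have N: "?N n = {\<zero>\<^bsub>piece J n\<^esub>}" for n
  proof (rule brown_gitler_submodule_trivial[OF J])
    show "submodule (?N n) F2 (piece J n)" for n
      using Sq1 Sq1_zero by (intro J.submoduleI_F2) auto
    show "?N 2 = {\<zero>\<^bsub>piece J 2\<^esub>}"
      by auto
    fix i n x assume x: "x \<in> ?N n"
    \<comment> \<open>Instability disposes of i > n. Among the rest, only Sq^1 in degree 1 reaches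
      degree 2 from below, and \<open>?N\<close> is defined to kill it; from degree 3 on everything
      stays above degree 2.\<close>
    consider "i = 0" | "n < i" | "n = 1" "i = 1" | "n = 2" | "2 < n + i" "\<not> n < i" "0 < i"
      by linarith
    then show "Sq J i n x \<in> ?N (n + i)"
    proof cases
      case 1
      then show ?thesis using x D(3) by simp
    next
      case 2
      then show ?thesis using x D(4)[of x n i] Sq1_zero by auto
    next
      case 3
      then show ?thesis using x by (auto simp: numeral_2_eq_2)
    next
      case 4
      then show ?thesis using x zero[of i 2] by (cases "i = 0") (auto simp: D(3))
    next
      case 5
      then show ?thesis using x D(5) by auto
    qed
  qed
  obtain z :: 'u where True by blast
  obtain w where w: "z \<noteq> w"
    using inf by (metis finite.simps infinite_imp_nonempty UNIV_eq_I insertI1)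
  let ?T = "test_module z w {2}" and ?T' = "test_module z w {1, 2}"
  have T: "unstable_module ?T" "unstable_module ?T'"
    using w by (auto intro: unstable_test_module)
  obtain \<phi> where \<phi>: "bij_betw \<phi> (A_Hom ?T J) (linear_dual (piece ?T 2))"
    using brown_gitlerD(2)[OF J T(1)] by blast
  obtain \<phi>' where \<phi>': "bij_betw \<phi>' (A_Hom ?T' J) (linear_dual (piece ?T' 2))"
    using brown_gitlerD(2)[OF J T(2)] by blast
  have 0: "carrier (piece J 0) = {\<zero>\<^bsub>piece J 0\<^esub>}"
    using N[of 0] by auto
  have 3: "carrier (piece J n) = {\<zero>\<^bsub>piece J n\<^esub>}" if "3 \<le> n" for n
    using N[of n] that by auto
  have ker: "x = \<zero>\<^bsub>piece J 1\<^esub>" if "x \<in> carrier (piece J 1)" "Sq J 1 1 x = \<zero>\<^bsub>piece J 2\<^esub>" for x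
    using N[of 1] that by auto
  have inj: "inj_on (Sq J 1 1) (carrier (piece J 1))"
    using linear_map_inj_on[OF D(1) D(1) D(2)[of 1 1]] ker by (simp add: numeral_2_eq_2)
  have two: "\<exists>c :: 'u \<Rightarrow> bit. inj_on c (carrier (piece J 2))"
  proof -
    \<comment> \<open>\<open>h e\<close> sends the generator w of degree 2 to \<open>e\<close>; it
      commutes with the squares because \<open>J\<close> vanishes above degree 2.\<close>
    define h where "h = (\<lambda>e n. restrict (\<lambda>x. if x = z then \<zero>\<^bsub>piece J n\<^esub> else e) (carrier (piece ?T n)))"
    have h: "h e \<in> A_Hom ?T J" if "e \<in> carrier (piece J 2)" for e
    proof -
      have "linear_map (piece ?T n) (piece J n) (h e n)" for n
        unfolding linear_map_iff[OF unstable_moduleD(1)[OF T(1)] D(1)]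
        using that w J.add_self[of e 2] by (auto simp: h_def test_module_def)
      moreover have "h e (n + i) (Sq ?T i n x) = Sq J i n (h e n x)"
        if "x \<in> carrier (piece ?T n)" for n i x
        using that w zero[of i n] D(3)[OF \<open>e \<in> carrier (piece J 2)\<close>] D(5)[OF \<open>e \<in> carrier (piece J 2)\<close>, of i] 3[of "2 + i"]
        by (auto simp: h_def test_module_def split: if_splits)
      ultimately show ?thesis
        by (auto simp: A_Hom_def A_map_def h_def)
    qed
    have "inj_on h (carrier (piece J 2))"
    proof (rule inj_onI)
      fix e e' assume "h e = h e'"
      then have "h e 2 w = h e' 2 w"
        by simp
      then show "e = e'"
        using w by (auto simp: h_def test_module_def)
    qed
    moreover have "inj_on \<phi> (h ` carrier (piece J 2))" "\<phi> ` h ` carrier (piece J 2) \<subseteq> linear_dual (piece ?T 2)"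
      using \<phi> h by (auto simp: bij_betw_def inj_on_def)
    moreover have "inj_on (\<lambda>f. f w) (linear_dual (piece ?T 2))"
      using linear_dual_test_module(2)[OF w] by simp
    ultimately have "inj_on ((\<lambda>f. f w) \<circ> (\<phi> \<circ> h)) (carrier (piece J 2))"
      by (intro comp_inj_on) (auto simp: image_comp intro: inj_on_subset)
    then show ?thesis
      by blast
  qed
  \<comment> \<open>With J^1 = 0, a map sends w in degree 1 to zero, hence also Sq^1 w, which is the
    class in degree 2. So Hom has one element, against two functionals.\<close>
  have "\<exists>a\<in>carrier (piece J 1). a \<noteq> \<zero>\<^bsub>piece J 1\<^esub>"
  proof (rule ccontr)
    assume "\<not> ?thesis"
    then have J1: "e = \<zero>\<^bsub>piece J 1\<^esub>" if "e \<in> carrier (piece J 1)" for e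
      using that by blast
    have w2: "Sq ?T' 1 1 w = w" "w \<in> carrier (piece ?T' 1)"
      by (auto simp: test_module_def)
    have eq: "f = g" if f: "f \<in> A_Hom ?T' J" and g: "g \<in> A_Hom ?T' J" for f g
    proof (intro ext)
      fix n x
      have z: "h n z = \<zero>\<^bsub>piece J n\<^esub>" if "h \<in> A_Hom ?T' J" for h n
        using linear_map_zero[OF unstable_moduleD(1)[OF T(2), of n] D(1) A_HomD(1)[OF that]]
        by (simp add: test_module_def)
      have 1: "h 1 w = \<zero>\<^bsub>piece J 1\<^esub>" if "h \<in> A_Hom ?T' J" for h
        using linear_map_closed[OF A_HomD(1)[OF that] w2(2)] J1 by simp
      have 2: "h 2 w = \<zero>\<^bsub>piece J 2\<^esub>" if "h \<in> A_Hom ?T' J" for h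
        using A_HomD(2)[OF that w2(2), of 1] w2(1) 1[OF that] zero[of 1 1] by (simp add: numeral_2_eq_2)
      show "f n x = g n x"
      proof (cases "x \<in> carrier (piece ?T' n)")
        case True
        then consider "x = z" | "x = w" "n = 1" | "x = w" "n = 2"
          by (auto simp: test_module_def split: if_splits)
        then show ?thesis
          using z[OF f] z[OF g] 1[OF f] 1[OF g] 2[OF f] 2[OF g] by cases auto
      next
        case False
        then show ?thesis
          using A_HomD(3)[OF f] A_HomD(3)[OF g] by (metis extensional_arb)
      qed
    qed
    have "\<phi>' f = \<phi>' g" if "f \<in> A_Hom ?T' J" "g \<in> A_Hom ?T' J" for f g
      using arg_cong[OF eq[OF that]] .
    then have "f = g" if "f \<in> linear_dual (piece ?T' 2)" "g \<in> linear_dual (piece ?T' 2)" for f g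
      using that unfolding bij_betw_imp_surj_on[OF \<phi>', symmetric] by blast
    then show False
      using linear_dual_test_module(1)[OF w, of "{1, 2}"] by blast
  qed
  then obtain a where a: "a \<in> carrier (piece J 1)" "a \<noteq> \<zero>\<^bsub>piece J 1\<^esub>"
    by blast
  have a2: "Sq J 1 1 a \<noteq> \<zero>\<^bsub>piece J 2\<^esub>" "Sq J 1 1 a \<in> carrier (piece J 2)"
    using ker a Sq1(1) by auto
  have J2: "carrier (piece J 2) = {\<zero>\<^bsub>piece J 2\<^esub>, Sq J 1 1 a}"
  proof -
    obtain c :: "'u \<Rightarrow> bit" where c: "inj_on c (carrier (piece J 2))"
      using two by blast
    have "e = Sq J 1 1 a" if "e \<in> carrier (piece J 2)" "e \<noteq> \<zero>\<^bsub>piece J 2\<^esub>" for e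
    proof -
      have "c e \<noteq> c \<zero>\<^bsub>piece J 2\<^esub>" "c (Sq J 1 1 a) \<noteq> c \<zero>\<^bsub>piece J 2\<^esub>"
        using c that a2 J.M.zero_closed by (metis inj_onD)+
      \<comment> \<open>Two bits that both differ from a third are equal.\<close>
      then have "c e = c (Sq J 1 1 a)"
        by (cases "c e"; cases "c (Sq J 1 1 a)"; cases "c \<zero>\<^bsub>piece J 2\<^esub>") simp_all
      then show ?thesis
        using c that a2 by (metis inj_onD)
    qed
    then show ?thesis
      using a2 J.M.zero_closed[of 2] by blast
  qed
  have J1: "carrier (piece J 1) = {\<zero>\<^bsub>piece J 1\<^esub>, a}"
  proof -
    have "e = a" if "e \<in> carrier (piece J 1)" "e \<noteq> \<zero>\<^bsub>piece J 1\<^esub>" for e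
      using inj_onD[OF inj _ that(1) a(1)] Sq1(1)[OF that(1) that(1)] ker[OF that(1)] that(2) J2 by auto
    then show ?thesis
      using a J.M.zero_closed[of 1] by blast
  qed
  show thesis
    by (rule that[OF 0 J1 a(2) J2 a2(1) 3])
qed

section \<open>\<open>H\<close>-\<open>A\<close>-modules with reduction \<open>J(2)\<close>\<close>

lemma ex_bit: "(\<exists>c :: bit. P c) \<longleftrightarrow> P 0 \<or> P 1"
  by (metis bit.exhaust)

lemma bit_add_self: "c + c = (0 :: bit)"
  by (cases c) auto

lemma bit_poly_add_self: "p + p = (0 :: bit poly)"
  by (intro poly_eqI) (simp only: coeff_add coeff_0 bit_add_self)

lemma HH_carrier: "carrier (piece HH i) = {Polynomial.smult c (tt ^ i) | c. True}"
  by (simp add: HH_def)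

lemma HH_add [simp]: "p \<oplus>\<^bsub>piece HH i\<^esub> q = p + q" "\<zero>\<^bsub>piece HH i\<^esub> = 0"
  "c \<odot>\<^bsub>piece HH i\<^esub> p = Polynomial.smult c p"
  by (simp_all add: HH_def)

lemma HH_carrier_iff: "p \<in> carrier (piece HH i) \<longleftrightarrow> p = 0 \<or> p = tt ^ i"
  unfolding HH_carrier by (simp add: ex_bit)

lemma tt_power_eq_monom: "tt ^ i = (monom 1 i :: bit poly)"
  by (simp add: monom_altdef)

lemma tt_carrier [simp]: "tt ^ i \<in> carrier (piece HH i)" "tt \<in> carrier (piece HH (Suc 0))"
  "1 \<in> carrier (piece HH 0)"
  by (simp_all add: HH_carrier_iff)

lemma HH_carrierE:
  assumes "h \<in> carrier (piece HH i)"
  shows "h = Polynomial.smult (coeff h i) (tt ^ i)"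
  using assms by (auto simp: HH_carrier_iff tt_power_eq_monom)

lemma Sq_HH: "Sq HH k i p = Polynomial.smult (of_nat (i choose k)) (tt ^ k * p)"
  by (simp add: HH_def of_nat_poly)

lemma act_HH: "act HH i n h p = h * p"
  by (simp add: HH_def)

lemma HA_moduleD:
  assumes "unstable_HA_module E"
  shows "unstable_module E"
    "h \<in> carrier (piece HH i) \<Longrightarrow> linear_map (piece E n) (piece E (i + n)) (act E i n h)"
    "x \<in> carrier (piece E n) \<Longrightarrow> linear_map (piece HH i) (piece E (i + n)) (\<lambda>h. act E i n h x)"
    "x \<in> carrier (piece E n) \<Longrightarrow> act E 0 n 1 x = x"
    "h \<in> carrier (piece HH i) \<Longrightarrow> h' \<in> carrier (piece HH j) \<Longrightarrow> x \<in> carrier (piece E n) \<Longrightarrow>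
      act E (i + j) n (h * h') x = act E i (j + n) h (act E j n h' x)"
    "h \<in> carrier (piece HH i) \<Longrightarrow> x \<in> carrier (piece E n) \<Longrightarrow>
      Sq E k (i + n) (act E i n h x) =
        (\<Oplus>\<^bsub>piece E (i + n + k)\<^esub> a\<in>{..k}.
          act E (i + a) (n + (k - a)) (Sq HH a i h) (Sq E (k - a) n x))"
  using assms unfolding unstable_HA_module_def by blast+

section \<open>Multiplication by powers of t and the Cartan formula\<close>

locale HA_module =
  fixes E :: "'e hmod"
  assumes HA: "unstable_HA_module E"
begin

text \<open>Since H^m is spanned by t^m, these maps carry the whole action of H.\<close>

definition T :: "nat \<Rightarrow> nat \<Rightarrow> 'e \<Rightarrow> 'e"
  where "T m n = act E m n (tt ^ m)"

lemmas unstable = HA_moduleD(1)[OF HA]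
lemmas Sq_zero = unstable_moduleD(3)[OF unstable]
lemmas Sq_above = unstable_moduleD(4)[OF unstable]
lemmas Sq_closed = unstable_moduleD(5)[OF unstable]
lemmas adem = unstable_module_adem[OF unstable]

lemma mod: "module F2 (piece E n)"
  by (rule unstable_moduleD(1)[OF unstable])

interpretation E: F2_module "piece E k" for k
  using mod by blast

lemma Sq_linear: "linear_map (piece E n) (piece E (n + i)) (Sq E i n)"
  by (rule unstable_moduleD(2)[OF unstable])

lemma T_linear: "linear_map (piece E n) (piece E (m + n)) (T m n)"
  unfolding T_def by (rule HA_moduleD(2)[OF HA]) simp

lemma T_closed: "x \<in> carrier (piece E n) \<Longrightarrow> T m n x \<in> carrier (piece E (m + n))"
  by (rule linear_map_closed[OF T_linear])

lemma T_zero: "T m n \<zero>\<^bsub>piece E n\<^esub> = \<zero>\<^bsub>piece E (m + n)\<^esub>"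
  by (rule linear_map_zero[OF mod mod T_linear])

lemma T_0: "x \<in> carrier (piece E n) \<Longrightarrow> T 0 n x = x"
  using HA_moduleD(4)[OF HA] by (simp add: T_def)

lemma T_T: "x \<in> carrier (piece E n) \<Longrightarrow> T i (j + n) (T j n x) = T (i + j) n x"
  using HA_moduleD(5)[OF HA tt_carrier(1) tt_carrier(1)] by (simp add: T_def power_add)

lemma act_smult:
  assumes "x \<in> carrier (piece E n)"
  shows "act E m n (Polynomial.smult c (tt ^ m)) x = c \<odot>\<^bsub>piece E (m + n)\<^esub> T m n x"
  using linear_map_smult[OF HA_moduleD(3)[OF HA assms] tt_carrier(1)] by (simp add: T_def)

lemma act_eq:
  assumes "x \<in> carrier (piece E n)" "h \<in> carrier (piece HH m)"
  shows "act E m n h x = coeff h m \<odot>\<^bsub>piece E (m + n)\<^esub> T m n x"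
  using act_smult[OF assms(1), of m "coeff h m"] HH_carrierE[OF assms(2)] by simp

text \<open>The coefficient comes from Sq^a t^i = (i choose a) t^(i+a). \<open>S\<close> is any
  index set outside which the contributing squares of \<open>x\<close> vanish; the generators of the
  free module have so few nonzero squares that at most two indices occur later.\<close>

lemma cartan:
  assumes x: "x \<in> carrier (piece E n)" and S: "S \<subseteq> {..k}"
    and zero: "\<And>a. a \<le> k \<Longrightarrow> a \<notin> S \<Longrightarrow> Sq E (k - a) n x = \<zero>\<^bsub>piece E (n + (k - a))\<^esub>"
  shows "Sq E k (i + n) (T i n x) =
    (\<Oplus>\<^bsub>piece E (i + n + k)\<^esub> a\<in>S. of_nat (i choose a) \<odot>\<^bsub>piece E (i + n + k)\<^esub>
       T (i + a) (n + (k - a)) (Sq E (k - a) n x))"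
proof -
  have idx: "i + a + (n + (k - a)) = i + n + k" if "a \<le> k" for a
    using that by simp
  have cl: "T (i + a) (n + (k - a)) (Sq E (k - a) n x) \<in> carrier (piece E (i + n + k))" if "a \<le> k" for a
    using T_closed[OF Sq_closed[OF x], of "i + a" "k - a"] unfolding idx[OF that] .
  have z: "T (i + a) (n + (k - a)) (Sq E (k - a) n x) = \<zero>\<^bsub>piece E (i + n + k)\<^esub>" if "a \<le> k" "a \<notin> S" for a
    using T_zero[of "i + a" "n + (k - a)"] unfolding idx[OF that(1)] zero[OF that] .
  have "Sq E k (i + n) (T i n x) = (\<Oplus>\<^bsub>piece E (i + n + k)\<^esub> a\<in>{..k}.
          act E (i + a) (n + (k - a)) (Sq HH a i (tt ^ i)) (Sq E (k - a) n x))"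
    unfolding T_def using HA_moduleD(6)[OF HA tt_carrier(1) x] .
  also have "\<dots> = (\<Oplus>\<^bsub>piece E (i + n + k)\<^esub> a\<in>{..k}. of_nat (i choose a) \<odot>\<^bsub>piece E (i + n + k)\<^esub>
       T (i + a) (n + (k - a)) (Sq E (k - a) n x))"
  proof (rule E.M.finsum_cong')
    fix a assume "a \<in> {..k}"
    then show "act E (i + a) (n + (k - a)) (Sq HH a i (tt ^ i)) (Sq E (k - a) n x) =
       of_nat (i choose a) \<odot>\<^bsub>piece E (i + n + k)\<^esub> T (i + a) (n + (k - a)) (Sq E (k - a) n x)"
      using act_smult[OF Sq_closed[OF x], of "i + a" "k - a" "of_nat (i choose a)"]
      by (simp add: idx Sq_HH add.commute[of a i] add.assoc flip: power_add)
  qed (use cl in auto)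
  also have "\<dots> = (\<Oplus>\<^bsub>piece E (i + n + k)\<^esub> a\<in>S. of_nat (i choose a) \<odot>\<^bsub>piece E (i + n + k)\<^esub>
       T (i + a) (n + (k - a)) (Sq E (k - a) n x))"
    using S z cl by (intro E.M.add.finprod_mono_neutral_cong_right) (auto simp: subset_iff)
  finally show ?thesis .
qed

text \<open>The Adem relation for Sq^1 Sq^b has the single term c = 0, with coefficient (b - 1
  choose 1) = b - 1. The instances of interest are Sq^1 Sq^1 = 0 and Sq^1 Sq^2 = Sq^3.\<close>

lemma Sq1_Sq:
  assumes z: "z \<in> carrier (piece E n)" and "0 < b"
  shows "Sq E 1 (n + b) (Sq E b n z) = of_nat (b - 1) \<odot>\<^bsub>piece E (n + 1 + b)\<^esub> Sq E (1 + b) n z"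
proof -
  have "Sq E (1 + b) n z \<in> carrier (piece E (n + 1 + b))"
    using Sq_closed[OF z, of "1 + b"] by (simp add: add.assoc)
  moreover have "{..1 div 2 :: nat} = {0}"
    by auto
  ultimately show ?thesis
    using adem[OF z, of 1 b] \<open>0 < b\<close> Sq_zero[OF z]
    by (simp add: E.finsum_singleton)
qed

end

text \<open>The free \<open>H\<close>-module on \<open>x\<close> in degree 1 and \<open>y = Sq\<^sup>1 x\<close> in degree 2 with
  \<open>Sq\<^sup>2 y = \<beta> t\<^sup>2 y\<close>; the pair \<open>(p, q)\<close> in degree \<open>n\<close> stands for \<open>p t\<^sup>n\<^sup>-\<^sup>1 x + q t\<^sup>n\<^sup>-\<^sup>2 y\<close>.\<close>

definition model :: "bit \<Rightarrow> (bit \<times> bit) hmod"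
  where "model \<beta> =
    \<lparr>piece = (\<lambda>n. vsp {(p, q). (n < 1 \<longrightarrow> p = 0) \<and> (n < 2 \<longrightarrow> q = 0)} 0 (+)
       (\<lambda>c (p, q). (c * p, c * q))),
     Sq = (\<lambda>k n (p, q). (p * of_nat (n - 1 choose k),
       p * (if k = 0 then 0 else of_nat (n - 1 choose (k - 1))) +
       q * (of_nat (n - 2 choose k) + \<beta> * (if k < 2 then 0 else of_nat (n - 2 choose (k - 2)))))),
     act = (\<lambda>i n h (p, q). (coeff h i * p, coeff h i * q))\<rparr>"

text \<open>The isomorphism is \<open>f\<close> after the inverse of \<open>g\<close>. Closure of
  the carriers of \<open>C\<close> under \<open>Sq\<close> and \<open>act\<close> is what lets the
  inverse cancel \<open>g\<close> on the result of an operation.\<close>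

lemma HA_map_compose_inv:
  fixes C :: "'c hmod" and E :: "'e hmod" and F :: "'f hmod"
  assumes C: "\<And>n. module F2 (piece C n)"
    "\<And>k n x. x \<in> carrier (piece C n) \<Longrightarrow> Sq C k n x \<in> carrier (piece C (n + k))"
    "\<And>i n h x. h \<in> carrier (piece HH i) \<Longrightarrow> x \<in> carrier (piece C n) \<Longrightarrow> act C i n h x \<in> carrier (piece C (i + n))"
    and g: "HA_map C E g" "\<And>n. bij_betw (g n) (carrier (piece C n)) (carrier (piece E n))"
    and f: "HA_map C F f" "\<And>n. bij_betw (f n) (carrier (piece C n)) (carrier (piece F n))"
  shows "HA_isomorphic E F"
proof -
  define r where "r = (\<lambda>n. inv_into (carrier (piece C n)) (g n))"
  have r: "r n (g n x) = x" if "x \<in> carrier (piece C n)" for n x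
    unfolding r_def using g(2)[of n] that by (simp add: bij_betw_inv_into_left)
  have E: "\<exists>y\<in>carrier (piece C n). x = g n y" if "x \<in> carrier (piece E n)" for x n
    using that bij_betw_imp_surj_on[OF g(2)] by blast
  have g_lin: "linear_map (piece C n) (piece E n) (g n)"
    and g_Sq: "x \<in> carrier (piece C n) \<Longrightarrow> g (n + i) (Sq C i n x) = Sq E i n (g n x)"
    and g_act: "h \<in> carrier (piece HH i) \<Longrightarrow> x \<in> carrier (piece C n) \<Longrightarrow>
      g (i + n) (act C i n h x) = act E i n h (g n x)" for i n x h
    using g(1) by (auto simp: HA_map_def A_map_def)
  have f_lin: "linear_map (piece C n) (piece F n) (f n)"
    and f_Sq: "x \<in> carrier (piece C n) \<Longrightarrow> f (n + i) (Sq C i n x) = Sq F i n (f n x)"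
    and f_act: "h \<in> carrier (piece HH i) \<Longrightarrow> x \<in> carrier (piece C n) \<Longrightarrow>
      f (i + n) (act C i n h x) = act F i n h (f n x)" for i n x h
    using f(1) by (auto simp: HA_map_def A_map_def)
  interpret C: F2_module "piece C k" for k
    using C(1) by blast
  have lin: "linear_map (piece E n) (piece F n) (f n \<circ> r n)" for n
    unfolding linear_map_def hom_def
  proof (intro conjI CollectI funcsetI ballI allI)
    fix x assume "x \<in> carrier (add_monoid (piece E n))"
    then obtain u where u: "u \<in> carrier (piece C n)" "x = g n u"
      using E by auto
    then show "(f n \<circ> r n) x \<in> carrier (add_monoid (piece F n))"
      using r linear_map_closed[OF f_lin] by simp
    fix y assume "y \<in> carrier (add_monoid (piece E n))"
    then obtain v where v: "v \<in> carrier (piece C n)" "y = g n v"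
      using E by auto
    show "(f n \<circ> r n) (x \<otimes>\<^bsub>add_monoid (piece E n)\<^esub> y) =
        (f n \<circ> r n) x \<otimes>\<^bsub>add_monoid (piece F n)\<^esub> (f n \<circ> r n) y"
      using u v r by (simp flip: linear_map_add[OF g_lin] linear_map_add[OF f_lin])
  next
    fix c x assume "x \<in> carrier (piece E n)"
    then obtain u where u: "u \<in> carrier (piece C n)" "x = g n u"
      using E by auto
    then show "(f n \<circ> r n) (c \<odot>\<^bsub>piece E n\<^esub> x) = c \<odot>\<^bsub>piece F n\<^esub> (f n \<circ> r n) x"
      using r by (simp flip: linear_map_smult[OF g_lin] linear_map_smult[OF f_lin])
  qed
  have "(f (n + i) \<circ> r (n + i)) (Sq E i n x) = Sq F i n ((f n \<circ> r n) x)"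
    if x: "x \<in> carrier (piece E n)" for i n x
  proof -
    obtain u where u: "u \<in> carrier (piece C n)" "x = g n u"
      using E x by auto
    then show ?thesis
      using r C(2) by (simp flip: g_Sq f_Sq)
  qed
  moreover have "(f (i + n) \<circ> r (i + n)) (act E i n h x) = act F i n h ((f n \<circ> r n) x)"
    if h: "h \<in> carrier (piece HH i)" and x: "x \<in> carrier (piece E n)" for i n h x
  proof -
    obtain u where u: "u \<in> carrier (piece C n)" "x = g n u"
      using E x by auto
    then show ?thesis
      using r C(3) h by (simp flip: g_act f_act)
  qed
  moreover have "bij_betw (f n \<circ> r n) (carrier (piece E n)) (carrier (piece F n))" for n
    unfolding r_def using bij_betw_trans[OF bij_betw_inv_into[OF g(2)] f(2)] .
  ultimately show ?thesis
    unfolding HA_isomorphic_def HA_map_def A_map_def using lin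
    by (intro exI[of _ "\<lambda>n. f n \<circ> r n"]) auto
qed

section \<open>Closure of the model, and E in coordinates with respect to x and Sq^1 x\<close>

lemma model_simps [simp]:
  "carrier (piece (model \<beta>) n) = {(p, q). (n < 1 \<longrightarrow> p = 0) \<and> (n < 2 \<longrightarrow> q = 0)}"
  "v \<oplus>\<^bsub>piece (model \<beta>) n\<^esub> w = v + w" "\<zero>\<^bsub>piece (model \<beta>) n\<^esub> = 0"
  "c \<odot>\<^bsub>piece (model \<beta>) n\<^esub> v = (c * fst v, c * snd v)"
  by (simp_all add: model_def split: prod.split)

lemma module_model: "module F2 (piece (model \<beta>) n)"
proof (rule F2_moduleI_carrier)
  fix u v w
  show "(u \<oplus>\<^bsub>piece (model \<beta>) n\<^esub> v) \<oplus>\<^bsub>piece (model \<beta>) n\<^esub> w =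
      u \<oplus>\<^bsub>piece (model \<beta>) n\<^esub> (v \<oplus>\<^bsub>piece (model \<beta>) n\<^esub> w)"
    "u \<oplus>\<^bsub>piece (model \<beta>) n\<^esub> v = v \<oplus>\<^bsub>piece (model \<beta>) n\<^esub> u"
    by (simp_all add: add.assoc add.commute)
  show "u \<oplus>\<^bsub>piece (model \<beta>) n\<^esub> u = \<zero>\<^bsub>piece (model \<beta>) n\<^esub>"
    by (simp add: plus_prod_def zero_prod_def bit_add_self)
qed (auto simp: zero_prod_def)

lemma model_Sq_closed: "x \<in> carrier (piece (model \<beta>) n) \<Longrightarrow> Sq (model \<beta>) k n x \<in> carrier (piece (model \<beta>) (n + k))"
  by (cases "n = 0"; cases "n = 1"; cases "k = 0") (auto simp: model_def)

lemma model_act_closed: "x \<in> carrier (piece (model \<beta>) n) \<Longrightarrow> act (model \<beta>) i n h x \<in> carrier (piece (model \<beta>) (i + n))"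
  by (auto simp: model_def)

text \<open>Freeness and the shape of the reduction, restated degree by degree inside
  \<open>E\<close>: t is injective, and modulo t only the classes of \<open>x\<close> and Sq^1 x
  remain. The arguments of this locale thus involve neither bases nor cosets.\<close>

locale J2_type = HA_module E for E :: "'e hmod" +
  fixes x :: 'e
  assumes x: "x \<noteq> \<zero>\<^bsub>piece E 1\<^esub>"
    and E0: "carrier (piece E 0) = {\<zero>\<^bsub>piece E 0\<^esub>}"
    and E1: "carrier (piece E 1) = {\<zero>\<^bsub>piece E 1\<^esub>, x}"
    and Sq1: "Sq E 1 1 x \<notin> T 1 1 ` carrier (piece E 1)"
    and E2: "\<And>e. e \<in> carrier (piece E 2) \<Longrightarrow>
      \<exists>z\<in>carrier (piece E 1). \<exists>c. e = T 1 1 z \<oplus>\<^bsub>piece E 2\<^esub> c \<odot>\<^bsub>piece E 2\<^esub> Sq E 1 1 x"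
    and E3: "\<And>n. 2 \<le> n \<Longrightarrow> carrier (piece E (Suc n)) = T 1 n ` carrier (piece E n)"
    and torsion_free: "\<And>n z. z \<in> carrier (piece E n) \<Longrightarrow> T 1 n z = \<zero>\<^bsub>piece E (Suc n)\<^esub> \<Longrightarrow> z = \<zero>\<^bsub>piece E n\<^esub>"
begin

definition y :: 'e
  where "y = Sq E 1 1 x"

text \<open>This is t^(n-1) x. In degree 0 the truncated exponent would give an element of the wrong
  degree, so zero is put there, as it is for \<open>ty\<close> in degrees below 2. Both then lie in
  \<open>piece E n\<close> for every n.\<close>

definition tx :: "nat \<Rightarrow> 'e"
  where "tx n = (if n = 0 then \<zero>\<^bsub>piece E n\<^esub> else T (n - 1) 1 x)"

definition ty :: "nat \<Rightarrow> 'e"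
  where "ty n = (if n < 2 then \<zero>\<^bsub>piece E n\<^esub> else T (n - 2) 2 y)"

definition comb :: "nat \<Rightarrow> bit \<times> bit \<Rightarrow> 'e"
  where "comb n v = fst v \<odot>\<^bsub>piece E n\<^esub> tx n \<oplus>\<^bsub>piece E n\<^esub> snd v \<odot>\<^bsub>piece E n\<^esub> ty n"

interpretation E: F2_module "piece E k" for k
  using mod by blast

lemma x_carrier: "x \<in> carrier (piece E 1)"
  using E1 by simp

lemma y_carrier: "y \<in> carrier (piece E 2)"
  unfolding y_def using Sq_closed[OF x_carrier, of 1] by (simp add: numeral_2_eq_2)

lemma tx_carrier: "tx n \<in> carrier (piece E n)"
  using T_closed[OF x_carrier, of "n - 1"] by (auto simp: tx_def)

lemma ty_carrier: "ty n \<in> carrier (piece E n)"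
  using T_closed[OF y_carrier, of "n - 2"] by (cases "n < 2") (simp_all add: ty_def del: add_2_eq_Suc')

lemma tx_1: "tx 1 = x"
  using T_0[OF x_carrier] by (simp add: tx_def)

lemma tx_2: "tx 2 = T 1 1 x"
  by (simp add: tx_def)

lemma ty_2: "ty 2 = y"
  using T_0[OF y_carrier] by (simp add: ty_def)

lemma T_tx: "0 < n \<Longrightarrow> T m n (tx n) = tx (m + n)"
  using T_T[OF x_carrier, of m "n - 1"] by (simp add: tx_def)

lemma T_ty: "2 \<le> n \<Longrightarrow> T m n (ty n) = ty (m + n)"
  using T_T[OF y_carrier, of m "n - 2"] by (simp add: ty_def del: add_2_eq_Suc')

lemma comb_carrier: "comb n v \<in> carrier (piece E n)"
  using tx_carrier ty_carrier by (simp add: comb_def)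

lemma linear_map_comb:
  assumes "linear_map (piece E n) (piece E m) f"
  shows "f (comb n v) = fst v \<odot>\<^bsub>piece E m\<^esub> f (tx n) \<oplus>\<^bsub>piece E m\<^esub> snd v \<odot>\<^bsub>piece E m\<^esub> f (ty n)"
  using tx_carrier[of n] ty_carrier[of n]
  by (simp add: comb_def linear_map_add[OF assms] linear_map_smult[OF assms])

lemma comb_add: "comb n (v + w) = comb n v \<oplus>\<^bsub>piece E n\<^esub> comb n w"
  using tx_carrier[of n] ty_carrier[of n] E.smult_l_distr[of _ _ _ n]
  by (simp add: comb_def E.M.a_ac)

lemma comb_smult: "comb n (c * p, c * q) = c \<odot>\<^bsub>piece E n\<^esub> comb n (p, q)"
  using tx_carrier[of n] ty_carrier[of n] by (simp add: comb_def E.smult_bit)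

lemma T_comb: "2 \<le> n \<Longrightarrow> T m n (comb n v) = comb (m + n) v"
  using linear_map_comb[OF T_linear, of m n v] by (simp add: T_tx T_ty comb_def)

abbreviation coords :: "nat \<Rightarrow> (bit \<times> bit) set"
  where "coords n \<equiv> {(p, q). (n < 1 \<longrightarrow> p = 0) \<and> (n < 2 \<longrightarrow> q = 0)}"

text \<open>In degree 2, y is neither 0 nor t x because it is not in t E^1, and t x is nonzero
  because t is injective. A relation in a higher degree can be divided by t.\<close>

lemma comb_kernel:
  assumes "v \<in> coords n" "comb n v = \<zero>\<^bsub>piece E n\<^esub>"
  shows "v = 0"
proof -
  have 2: "v = 0" if "comb 2 v = \<zero>\<^bsub>piece E 2\<^esub>" for v
  proof -
    have "y \<noteq> T 1 1 x" "y \<noteq> \<zero>\<^bsub>piece E 2\<^esub>"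
      using Sq1 E1 T_zero[of 1 1] unfolding y_def by (auto simp: image_iff numeral_2_eq_2)
    then have ty2: "ty 2 \<noteq> tx 2" "ty 2 \<noteq> \<zero>\<^bsub>piece E 2\<^esub>"
      using tx_2 ty_2 by simp_all
    have "T 1 1 x \<noteq> \<zero>\<^bsub>piece E 2\<^esub>"
      using torsion_free[OF x_carrier] x by (auto simp: numeral_2_eq_2)
    then have tx2: "tx 2 \<noteq> \<zero>\<^bsub>piece E 2\<^esub>"
      using tx_2 by simp
    have "fst v \<odot>\<^bsub>piece E 2\<^esub> tx 2 = snd v \<odot>\<^bsub>piece E 2\<^esub> ty 2"
      using that tx_carrier[of 2] ty_carrier[of 2] by (simp add: comb_def E.add_eq_zero_iff)
    then show ?thesis
      using ty2 tx2 tx_carrier[of 2] ty_carrier[of 2]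
      by (simp add: E.smult_bit prod_eq_iff split: if_splits)
  qed
  consider "n = 0" | "n = 1" | "2 \<le> n"
    by linarith
  then show ?thesis
  proof cases
    case 1
    then show ?thesis
      using assms by (auto simp: zero_prod_def)
  next
    case 2
    show ?thesis
      using 2 assms tx_carrier[of 1] ty_carrier[of 1] x tx_1
      by (auto simp: comb_def E.smult_bit zero_prod_def split: if_splits)
  next
    case 3
    then show ?thesis
      using assms(2)
    proof (induction rule: dec_induct)
      case base
      then show ?case
        using 2 by simp
    next
      case (step n)
      then have "T 1 n (comb n v) = \<zero>\<^bsub>piece E (Suc n)\<^esub>"
        using T_comb[of n 1 v] by simp
      then show ?case
        using step torsion_free comb_carrier by blast
    qed
  qed
qed

text \<open>Degree 2 is generated by t x and y; above it, E^(n+1) = t E^n carries the same pair of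
  coordinates upwards.\<close>

lemma comb_surj:
  assumes "e \<in> carrier (piece E n)"
  shows "\<exists>v\<in>coords n. e = comb n v"
proof -
  consider "n = 0" | "n = 1" | "2 \<le> n"
    by linarith
  then show ?thesis
  proof cases
    case 1
    then show ?thesis
      using assms E0 by (intro bexI[of _ "(0, 0)"]) (auto simp: comb_def E.smult_bit tx_def ty_def)
  next
    case 2
    have "\<zero>\<^bsub>piece E 1\<^esub> = comb 1 (0, 0)" "x = comb 1 (1, 0)"
      using tx_carrier[of 1] ty_carrier[of 1] tx_1 by (simp_all add: comb_def E.smult_bit)
    moreover have "(0, 0) \<in> coords n" "(1, 0) \<in> coords n"
      using 2 by auto
    moreover have "e = \<zero>\<^bsub>piece E 1\<^esub> \<or> e = x"
      using assms E1 2 by simp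
    ultimately show ?thesis
      using 2 by metis
  next
    case 3
    have "\<exists>v. e = comb n v"
      using 3 assms
    proof (induction arbitrary: e rule: dec_induct)
      case base
      then obtain z c where z: "z \<in> carrier (piece E 1)" "e = T 1 1 z \<oplus>\<^bsub>piece E 2\<^esub> c \<odot>\<^bsub>piece E 2\<^esub> y"
        using E2 unfolding y_def by blast
      have "T 1 1 \<zero>\<^bsub>piece E 1\<^esub> = 0 \<odot>\<^bsub>piece E 2\<^esub> tx 2" "T 1 1 x = 1 \<odot>\<^bsub>piece E 2\<^esub> tx 2"
        using T_zero[of 1 1] tx_carrier[of 2] tx_2 by (simp_all add: E.smult_bit numeral_2_eq_2)
      then have "\<exists>d. T 1 1 z = d \<odot>\<^bsub>piece E 2\<^esub> tx 2"
        using z(1) E1 by auto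
      then obtain d where "T 1 1 z = d \<odot>\<^bsub>piece E 2\<^esub> tx 2" ..
      then have "e = comb 2 (d, c)"
        using z(2) by (simp add: comb_def ty_2)
      then show ?case ..
    next
      case (step n)
      then obtain z where z: "z \<in> carrier (piece E n)" "e = T 1 n z"
        using E3 by blast
      then obtain v where "z = comb n v"
        using step.IH by blast
      then show ?case
        using z step.hyps T_comb[of n 1 v] by (intro exI[of _ v]) simp
    qed
    then show ?thesis
      using 3 by auto
  qed
qed

text \<open>\<open>\<beta>\<close> is arbitrary here, as it enters the squares of the model but not
  its carriers.\<close>

lemma comb_bij: "bij_betw (comb n) (carrier (piece (model \<beta>) n)) (carrier (piece E n))"
proof -
  have lin: "linear_map (piece (model \<beta>) n) (piece E n) (comb n)"
    unfolding linear_map_iff[OF module_model mod] using comb_carrier comb_add by simp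
  have "inj_on (comb n) (carrier (piece (model \<beta>) n))"
    using comb_kernel by (intro linear_map_inj_on[OF module_model mod lin]) simp
  moreover have "comb n ` carrier (piece (model \<beta>) n) = carrier (piece E n)"
  proof (intro equalityI subsetI)
    fix e assume "e \<in> carrier (piece E n)"
    then show "e \<in> comb n ` carrier (piece (model \<beta>) n)"
      using comb_surj[of e n] unfolding model_simps by blast
  qed (use comb_carrier in blast)
  ultimately show ?thesis
    by (simp add: bij_betw_def)
qed

lemma Sq_x: "2 \<le> i \<Longrightarrow> Sq E i 1 x = \<zero>\<^bsub>piece E (1 + i)\<^esub>"
  using Sq_above[OF x_carrier] by simp

text \<open>By instability \<open>x\<close> has only the squares Sq^0 x = x and Sq^1 x = y, so the
  Cartan formula keeps a = k and a = k - 1. For k = 0 these indices coincide under truncated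
  subtraction, whence the separate case.\<close>

lemma Sq_tx:
  assumes "0 < n"
  shows "Sq E k n (tx n) = of_nat (n - 1 choose k) \<odot>\<^bsub>piece E (n + k)\<^esub> tx (n + k) \<oplus>\<^bsub>piece E (n + k)\<^esub>
    (if k = 0 then 0 else of_nat (n - 1 choose (k - 1))) \<odot>\<^bsub>piece E (n + k)\<^esub> ty (n + k)"
proof (cases "k = 0")
  case True
  then show ?thesis
    using Sq_zero[OF tx_carrier] tx_carrier[of n] ty_carrier[of n] by (simp add: E.smult_bit)
next
  case False
  let ?P = "piece E (n + k)"
  have idx: "n - 1 + 1 = n" "n - 1 + k = n + k - 1" "n - 1 + (k - 1) = n + k - 2" "k - (k - 1) = 1" "1 + 1 = (2 :: nat)"
    using assms False by auto
  have "Sq E k (n - 1 + 1) (T (n - 1) 1 x) =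
      (\<Oplus>\<^bsub>piece E (n - 1 + 1 + k)\<^esub> a\<in>{k, k - 1}. of_nat (n - 1 choose a) \<odot>\<^bsub>piece E (n - 1 + 1 + k)\<^esub>
       T (n - 1 + a) (1 + (k - a)) (Sq E (k - a) 1 x))"
  proof (rule cartan[OF x_carrier])
    show "Sq E (k - a) 1 x = \<zero>\<^bsub>piece E (1 + (k - a))\<^esub>" if "a \<le> k" "a \<notin> {k, k - 1}" for a
      using that by (intro Sq_x) auto
  qed auto
  also have "T (n - 1) 1 x = tx n"
    using assms by (simp add: tx_def)
  finally have "Sq E k n (tx n) = (\<Oplus>\<^bsub>?P\<^esub> a\<in>{k, k - 1}. of_nat (n - 1 choose a) \<odot>\<^bsub>?P\<^esub>
       T (n - 1 + a) (1 + (k - a)) (Sq E (k - a) 1 x))"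
    by (simp only: idx)
  moreover have "T (n - 1 + k) (1 + (k - k)) (Sq E (k - k) 1 x) = tx (n + k)"
    using Sq_zero[OF x_carrier] assms by (simp add: tx_def idx)
  moreover have "T (n - 1 + (k - 1)) (1 + (k - (k - 1))) (Sq E (k - (k - 1)) 1 x) = ty (n + k)"
    unfolding idx y_def[symmetric] using False assms by (simp add: ty_def)
  ultimately show ?thesis
    using tx_carrier[of "n + k"] ty_carrier[of "n + k"] False by simp
qed

lemma Sq1_y: "Sq E 1 2 y = \<zero>\<^bsub>piece E 3\<^esub>"
  using Sq1_Sq[OF x_carrier, of 1] Sq_closed[OF x_carrier, of 2]
  by (simp add: y_def E.smult_bit numeral_2_eq_2 numeral_3_eq_3)

text \<open>Sq^1 y = 0 and instability leave Sq^0 y and Sq^2 y, that is a = k and a = k - 2. The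
  class Sq^2 y stays unevaluated, because its evaluation relies on this formula for k = 1.\<close>

lemma Sq_ty_aux:
  assumes "2 \<le> n"
  shows "Sq E k n (ty n) = of_nat (n - 2 choose k) \<odot>\<^bsub>piece E (n + k)\<^esub> ty (n + k) \<oplus>\<^bsub>piece E (n + k)\<^esub>
    (if k < 2 then \<zero>\<^bsub>piece E (n + k)\<^esub> else of_nat (n - 2 choose (k - 2)) \<odot>\<^bsub>piece E (n + k)\<^esub> T (n + k - 4) 4 (Sq E 2 2 y))"
proof -
  let ?P = "piece E (n + k)"
  have z: "Sq E i 2 y = \<zero>\<^bsub>piece E (2 + i)\<^esub>" if "i \<noteq> 0" "i \<noteq> 2" for i
    using that Sq1_y Sq_above[OF y_carrier, of i] by (cases "i = 1") auto
  have idx: "n - 2 + 2 = n" "n - 2 + k = n + k - 2"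
    using assms by auto
  have tyn: "T (n - 2) 2 y = ty n"
    using assms by (simp add: ty_def)
  have tyk: "T (n - 2 + k) (2 + (k - k)) (Sq E (k - k) 2 y) = ty (n + k)"
    using Sq_zero[OF y_carrier] assms by (simp add: ty_def idx)
  show ?thesis
  proof (cases "k < 2")
    case True
    have "Sq E k (n - 2 + 2) (T (n - 2) 2 y) =
      (\<Oplus>\<^bsub>piece E (n - 2 + 2 + k)\<^esub> a\<in>{k}. of_nat (n - 2 choose a) \<odot>\<^bsub>piece E (n - 2 + 2 + k)\<^esub>
       T (n - 2 + a) (2 + (k - a)) (Sq E (k - a) 2 y))"
    proof (rule cartan[OF y_carrier])
      show "Sq E (k - a) 2 y = \<zero>\<^bsub>piece E (2 + (k - a))\<^esub>" if "a \<le> k" "a \<notin> {k}" for a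
        using that True by (intro z) auto
    qed auto
    then have "Sq E k n (ty n) = (\<Oplus>\<^bsub>?P\<^esub> a\<in>{k}. of_nat (n - 2 choose a) \<odot>\<^bsub>?P\<^esub>
       T (n - 2 + a) (2 + (k - a)) (Sq E (k - a) 2 y))"
      by (simp only: idx tyn)
    with tyk show ?thesis
      using ty_carrier[of "n + k"] True by (simp add: E.finsum_singleton del: add_2_eq_Suc)
  next
    case False
    have "Sq E k (n - 2 + 2) (T (n - 2) 2 y) =
      (\<Oplus>\<^bsub>piece E (n - 2 + 2 + k)\<^esub> a\<in>{k, k - 2}. of_nat (n - 2 choose a) \<odot>\<^bsub>piece E (n - 2 + 2 + k)\<^esub>
       T (n - 2 + a) (2 + (k - a)) (Sq E (k - a) 2 y))"
    proof (rule cartan[OF y_carrier])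
      show "Sq E (k - a) 2 y = \<zero>\<^bsub>piece E (2 + (k - a))\<^esub>" if "a \<le> k" "a \<notin> {k, k - 2}" for a
        using that False by (intro z) auto
    qed auto
    then have "Sq E k n (ty n) = (\<Oplus>\<^bsub>?P\<^esub> a\<in>{k, k - 2}. of_nat (n - 2 choose a) \<odot>\<^bsub>?P\<^esub>
       T (n - 2 + a) (2 + (k - a)) (Sq E (k - a) 2 y))"
      by (simp only: idx tyn)
    moreover have idx': "n - 2 + (k - 2) = n + k - 4" "k - (k - 2) = 2" "2 + 2 = (4 :: nat)" "n + k - 4 + 4 = n + k"
      using False assms by auto
    then have "T (n - 2 + (k - 2)) (2 + (k - (k - 2))) (Sq E (k - (k - 2)) 2 y) = T (n + k - 4) 4 (Sq E 2 2 y)"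
      by simp
    moreover have "T (n + k - 4) 4 (Sq E 2 2 y) \<in> carrier ?P"
      using T_closed[OF Sq_closed[OF y_carrier, of 2], of "n + k - 4"] unfolding idx' .
    moreover have "k \<noteq> k - 2"
      using False by simp
    ultimately show ?thesis
      using ty_carrier[of "n + k"] tyk False by (simp del: add_2_eq_Suc)
  qed
qed

text \<open>The relation \<open>Sq\<^sup>1 Sq\<^sup>2 = Sq\<^sup>3\<close> and instability exclude a term \<open>t\<^sup>3 x\<close> in \<open>Sq\<^sup>2 y\<close>.\<close>

lemma Sq2_y: "\<exists>\<beta>. Sq E 2 2 y = \<beta> \<odot>\<^bsub>piece E 4\<^esub> ty 4"
proof -
  have "Sq E 2 2 y \<in> carrier (piece E 4)"
    using Sq_closed[OF y_carrier, of 2] by simp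
  then obtain v where v: "Sq E 2 2 y = comb 4 v"
    using comb_surj by blast
  have "Sq E 1 4 (comb 4 v) = \<zero>\<^bsub>piece E 5\<^esub>"
    using Sq1_Sq[OF y_carrier, of 2] Sq_above[OF y_carrier, of 3]
    by (simp add: v del: add_2_eq_Suc')
  \<comment> \<open>(3 choose 1) is odd, so Sq^1(t^3 x) = t^4 x + t^3 y; (2 choose 1) is even, so
    Sq^1(t^2 y) = 0. The coefficient of t^3 x therefore reappears as both coordinates in degree
    5.\<close>
  moreover have "Sq E 1 4 (tx 4) = tx 5 \<oplus>\<^bsub>piece E 5\<^esub> ty 5"
    using Sq_tx[of 4 1] tx_carrier[of 5] ty_carrier[of 5] by (simp add: E.smult_bit)
  moreover have "Sq E 1 4 (ty 4) = \<zero>\<^bsub>piece E 5\<^esub>"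
    using Sq_ty_aux[of 4 1] ty_carrier[of 5] by (simp add: E.smult_bit)
  ultimately have "comb 5 (fst v, fst v) = \<zero>\<^bsub>piece E 5\<^esub>"
    using linear_map_comb[OF Sq_linear, of 1 4 v] tx_carrier[of 5] ty_carrier[of 5]
    by (simp add: comb_def E.smult_bit split: if_splits)
  then have "fst v = 0"
    using comb_kernel[of "(fst v, fst v)" 5] by (simp add: zero_prod_def)
  then show ?thesis
    using v tx_carrier[of 4] ty_carrier[of 4] by (intro exI[of _ "snd v"]) (simp add: comb_def E.smult_bit)
qed

lemma model_HA_map: "\<exists>\<beta>. HA_map (model \<beta>) E comb"
proof -
  obtain \<beta> where \<beta>: "Sq E 2 2 y = \<beta> \<odot>\<^bsub>piece E 4\<^esub> ty 4"
    using Sq2_y by blast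
  have Sq_ty: "Sq E k n (ty n) = (of_nat (n - 2 choose k) + \<beta> * (if k < 2 then 0 else of_nat (n - 2 choose (k - 2))))
      \<odot>\<^bsub>piece E (n + k)\<^esub> ty (n + k)" if "2 \<le> n" for k n
  proof -
    have "T (n + k - 4) 4 (Sq E 2 2 y) = \<beta> \<odot>\<^bsub>piece E (n + k)\<^esub> ty (n + k)" if "2 \<le> k"
      unfolding \<beta> using linear_map_smult[OF T_linear ty_carrier, of "n + k - 4" 4 \<beta>] T_ty[of 4 "n + k - 4"] that \<open>2 \<le> n\<close>
      by simp
    then show ?thesis
      using Sq_ty_aux[OF that, of k] ty_carrier[of "n + k"]
      by (cases \<beta>; cases "of_nat (n - 2 choose k) :: bit"; cases "of_nat (n - 2 choose (k - 2)) :: bit")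
        (simp_all add: E.smult_bit E.add_self)
  qed
  have Sq: "comb (n + k) (Sq (model \<beta>) k n v) = Sq E k n (comb n v)"
    if "v \<in> carrier (piece (model \<beta>) n)" for k n v
  proof -
    obtain p q where v: "v = (p, q)" by fastforce
    let ?tx = "tx (n + k)" and ?ty = "ty (n + k)" and ?P = "piece E (n + k)"
    have c: "?tx \<in> carrier ?P" "?ty \<in> carrier ?P"
      by (rule tx_carrier ty_carrier)+
    have p: "p \<odot>\<^bsub>?P\<^esub> Sq E k n (tx n) = (p * of_nat (n - 1 choose k)) \<odot>\<^bsub>?P\<^esub> ?tx \<oplus>\<^bsub>?P\<^esub>
        (p * (if k = 0 then 0 else of_nat (n - 1 choose (k - 1)))) \<odot>\<^bsub>?P\<^esub> ?ty"
    \<comment> \<open>\<open>Sq_tx\<close> requires positive degree; in degree 0 the coordinate p is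
      zero.\<close>
    proof (cases "n = 0")
      case True
      then have "p = 0" using that by (auto simp: model_def v)
      then show ?thesis
        using c Sq_closed[OF tx_carrier, of k n] by (simp add: E.smult_bit)
    next
      case False
      then show ?thesis
        unfolding Sq_tx[OF False[unfolded neq0_conv]] using c by (simp add: E.smult_bit)
    qed
    have q: "q \<odot>\<^bsub>?P\<^esub> Sq E k n (ty n) =
        (q * (of_nat (n - 2 choose k) + \<beta> * (if k < 2 then 0 else of_nat (n - 2 choose (k - 2))))) \<odot>\<^bsub>?P\<^esub> ?ty"
    proof (cases "n < 2")
      case True
      then have "q = 0" using that by (auto simp: model_def v)
      then show ?thesis
        using c Sq_closed[OF ty_carrier, of k n] by (simp add: E.smult_bit)
    next
      case False
      then have "2 \<le> n" by simp
      show ?thesis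
        unfolding Sq_ty[OF \<open>2 \<le> n\<close>] using c(2) by (cases q) (simp_all only: E.smult_bit mult_zero_left mult_1 if_True if_False one_neq_zero E.M.zero_closed simp_thms split: if_split)
    qed
    \<comment> \<open>With the coefficients treated as opaque bits, what remains is a finite check
      in which equal terms cancel in characteristic 2.\<close>
    define A B C :: bit where "A = of_nat (n - 1 choose k)"
      and "B = (if k = 0 then 0 else of_nat (n - 1 choose (k - 1)))"
      and "C = of_nat (n - 2 choose k) + \<beta> * (if k < 2 then 0 else of_nat (n - 2 choose (k - 2)))"
    have "Sq (model \<beta>) k n v = (p * A, p * B + q * C)"
      by (simp add: model_def v A_def B_def C_def)
    moreover have "Sq E k n (comb n v) = (p * A) \<odot>\<^bsub>?P\<^esub> ?tx \<oplus>\<^bsub>?P\<^esub> (p * B) \<odot>\<^bsub>?P\<^esub> ?ty \<oplus>\<^bsub>?P\<^esub> (q * C) \<odot>\<^bsub>?P\<^esub> ?ty"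
      unfolding linear_map_comb[OF Sq_linear] v A_def B_def C_def fst_conv snd_conv p q ..
    ultimately show ?thesis
      using c by (cases A; cases B; cases C; cases p; cases q)
        (simp_all add: comb_def E.smult_bit E.add_self E.M.a_assoc)
  qed
  have act: "comb (i + n) (act (model \<beta>) i n h v) = act E i n h (comb n v)"
    if "h \<in> carrier (piece HH i)" "v \<in> carrier (piece (model \<beta>) n)" for i n h v
  proof -
    obtain p q where v: "v = (p, q)" by fastforce
    have "p \<odot>\<^bsub>piece E (i + n)\<^esub> T i n (tx n) = p \<odot>\<^bsub>piece E (i + n)\<^esub> tx (i + n)"
      using that(2) T_tx[of n i] tx_carrier[of "i + n"] T_closed[OF tx_carrier, of i n]
      by (cases "n = 0") (auto simp: v model_def E.smult_bit)
    moreover have "q \<odot>\<^bsub>piece E (i + n)\<^esub> T i n (ty n) = q \<odot>\<^bsub>piece E (i + n)\<^esub> ty (i + n)"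
      using that(2) T_ty[of n i] ty_carrier[of "i + n"] T_closed[OF ty_carrier, of i n]
      by (cases "n < 2") (auto simp: v model_def E.smult_bit)
    ultimately have "T i n (comb n v) = comb (i + n) v"
      unfolding linear_map_comb[OF T_linear] by (simp add: v comb_def)
    then show ?thesis
      unfolding act_eq[OF comb_carrier that(1)] by (simp add: v model_def flip: comb_smult)
  qed
  have "linear_map (piece (model \<beta>) n) (piece E n) (comb n)" for n
    unfolding linear_map_iff[OF module_model mod] using comb_carrier comb_add by simp
  then show ?thesis
    unfolding HA_map_def A_map_def using Sq act by blast
qed

lemma model_isomorphism:
  "\<exists>\<beta> g. HA_map (model \<beta>) E g \<and> (\<forall>n. bij_betw (g n) (carrier (piece (model \<beta>) n)) (carrier (piece E n)))"
  using model_HA_map comb_bij by blast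

end

text \<open>Multiplying all coefficients in the expansion of \<open>z\<close> by t gives an
  expansion of t z = 0 over the same basis. Uniqueness identifies it with the zero expansion, and
  multiplication by t loses no key because F_2[t] is a domain.\<close>

lemma (in HA_module) free_torsion_free:
  assumes free: "free_H_module E" and z: "z \<in> carrier (piece E n)" "T 1 n z = \<zero>\<^bsub>piece E (Suc n)\<^esub>"
  shows "z = \<zero>\<^bsub>piece E n\<^esub>"
proof -
  let ?coeffs = "\<lambda>B n (c :: (nat \<times> 'e) \<Rightarrow>\<^sub>0 bit poly). \<forall>(d, b)\<in>Poly_Mapping.keys c.
      (d, b) \<in> B \<and> d \<le> n \<and> Poly_Mapping.lookup c (d, b) \<in> carrier (piece HH (n - d))"
  let ?comb = "\<lambda>n (c :: (nat \<times> 'e) \<Rightarrow>\<^sub>0 bit poly). \<Oplus>\<^bsub>piece E n\<^esub> e\<in>Poly_Mapping.keys c.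
      act E (n - fst e) (fst e) (Poly_Mapping.lookup c e) (snd e)"
  obtain B where B0: "\<forall>(d, b)\<in>B. b \<in> carrier (piece E d)"
    and basis0: "\<forall>n. \<forall>x\<in>carrier (piece E n). \<exists>!c. ?coeffs B n c \<and> x = ?comb n c"
    using free unfolding free_H_module_def by (elim exE conjE) rule
  have B: "b \<in> carrier (piece E d)" if "(d, b) \<in> B" for d b
    using B0 that by auto
  have basis: "\<exists>!c. ?coeffs B n c \<and> x = ?comb n c" if "x \<in> carrier (piece E n)" for n x
    using basis0 that by (elim allE ballE) auto
  interpret E: F2_module "piece E k" for k
    using mod by blast
  obtain c where c0: "?coeffs B n c" and z_eq: "z = ?comb n c"
    using basis[OF z(1)] by (elim ex1E conjE) rule
  have c: "(d, b) \<in> B \<and> d \<le> n \<and> Poly_Mapping.lookup c (d, b) \<in> carrier (piece HH (n - d))"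
    if "(d, b) \<in> Poly_Mapping.keys c" for d b
    using c0 that by auto
  define c' where "c' = Poly_Mapping.map ((*) tt) c"
  have lookup: "Poly_Mapping.lookup c' e = tt * Poly_Mapping.lookup c e" for e
    unfolding c'_def by (simp add: Poly_Mapping.map.rep_eq when_def)
  then have keys: "Poly_Mapping.keys c' = Poly_Mapping.keys c"
    by (auto simp: in_keys_iff)
  have summand: "act E (n - fst e) (fst e) (Poly_Mapping.lookup c e) (snd e) \<in> carrier (piece E n)"
    "T 1 n (act E (n - fst e) (fst e) (Poly_Mapping.lookup c e) (snd e)) =
      act E (Suc n - fst e) (fst e) (Poly_Mapping.lookup c' e) (snd e)"
    and c': "fst e \<le> Suc n" "e \<in> B" "Poly_Mapping.lookup c' e \<in> carrier (piece HH (Suc n - fst e))"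
    if "e \<in> Poly_Mapping.keys c" for e
  proof -
    obtain d b where e: "e = (d, b)" by fastforce
    have *: "(d, b) \<in> B" "d \<le> n" "Poly_Mapping.lookup c (d, b) \<in> carrier (piece HH (n - d))"
      using c that e by auto
    have idx: "n - d + d = n" "1 + (n - d) = Suc n - d"
      using *(2) by auto
    show "act E (n - fst e) (fst e) (Poly_Mapping.lookup c e) (snd e) \<in> carrier (piece E n)"
      using linear_map_closed[OF HA_moduleD(2)[OF HA *(3)] B[OF *(1)]] by (simp add: e idx)
    show "T 1 n (act E (n - fst e) (fst e) (Poly_Mapping.lookup c e) (snd e)) =
      act E (Suc n - fst e) (fst e) (Poly_Mapping.lookup c' e) (snd e)"
      using HA_moduleD(5)[OF HA _ *(3) B[OF *(1)], of tt 1] unfolding idx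
      by (simp add: e T_def lookup)
    show "fst e \<le> Suc n" "e \<in> B"
      using * e by auto
    have "tt ^ (Suc n - d) = tt * tt ^ (n - d)"
      using *(2) by (simp add: Suc_diff_le)
    then show "Poly_Mapping.lookup c' e \<in> carrier (piece HH (Suc n - fst e))"
      using *(3) by (auto simp: e lookup HH_carrier_iff)
  qed
  have "T 1 n z = (\<Oplus>\<^bsub>piece E (Suc n)\<^esub> e\<in>Poly_Mapping.keys c.
      T 1 n (act E (n - fst e) (fst e) (Poly_Mapping.lookup c e) (snd e)))"
    unfolding z_eq using linear_map_finsum[OF mod mod T_linear, of "Poly_Mapping.keys c" _ n 1] summand(1)
    by (simp add: Pi_iff comp_def)
  also have "\<dots> = (\<Oplus>\<^bsub>piece E (Suc n)\<^esub> e\<in>Poly_Mapping.keys c'.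
      act E (Suc n - fst e) (fst e) (Poly_Mapping.lookup c' e) (snd e))"
    unfolding keys using summand T_closed[OF summand(1), of _ 1] by (intro E.M.finsum_cong') auto
  finally have zero: "\<zero>\<^bsub>piece E (Suc n)\<^esub> = (\<Oplus>\<^bsub>piece E (Suc n)\<^esub> e\<in>Poly_Mapping.keys c'.
      act E (Suc n - fst e) (fst e) (Poly_Mapping.lookup c' e) (snd e))"
    using z(2) by simp
  have "\<exists>!c. ?coeffs B (Suc n) c \<and> \<zero>\<^bsub>piece E (Suc n)\<^esub> = ?comb (Suc n) c"
    by (rule basis) simp
  \<comment> \<open>Uniqueness in degree n + 1 is about to be applied to two expansions of zero:
    \<open>c'\<close> and the empty one.\<close>
  then obtain u where u: "\<forall>c. ?coeffs B (Suc n) c \<and> \<zero>\<^bsub>piece E (Suc n)\<^esub> = ?comb (Suc n) c \<longrightarrow> c = u"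
    by (rule ex1E) (rule that, assumption)
  have "c' = u"
    using c' keys by (intro u[THEN spec, THEN mp] conjI zero) fastforce
  moreover have "0 = u"
    by (intro u[THEN spec, THEN mp]) simp_all
  ultimately have "c' = 0"
    by simp
  then have "Poly_Mapping.keys c = {}"
    using keys by simp
  then show ?thesis
    using z_eq by simp
qed

section \<open>Cosets, the augmentation part and the reduction\<close>

context F2_module
begin

lemma submodule_abelian_subgroup: "submodule W F2 V \<Longrightarrow> abelian_subgroup W V"
  using M.abelian_group_axioms
  by (auto intro!: abelian_subgroupI3 additive_subgroup.intro dest: submodule.axioms(1))

lemma mem_coset_iff:
  assumes "submodule W F2 V" "x \<in> carrier V" "y \<in> carrier V"
  shows "y \<in> W +> x \<longleftrightarrow> y \<oplus> x \<in> W"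
proof -
  have W: "W \<subseteq> carrier V"
    using assms submoduleE by blast
  have eq: "(w \<oplus> x) \<oplus> x = w" if "w \<in> carrier V" for w
    using that assms by (simp add: M.a_assoc add_self)
  then have "y = w \<oplus> x \<longleftrightarrow> w = y \<oplus> x" if "w \<in> W" for w
    using that W assms by auto
  then have "(\<exists>w\<in>W. y = w \<oplus> x) \<longleftrightarrow> (\<exists>w\<in>W. w = y \<oplus> x)"
    by (intro bex_cong) simp_all
  then show ?thesis
    by (simp add: a_r_coset_def')
qed

lemma coset_eq_iff:
  assumes "submodule W F2 V" "x \<in> carrier V" "y \<in> carrier V"
  shows "W +> x = W +> y \<longleftrightarrow> x \<oplus> y \<in> W"
proof -
  interpret W: abelian_subgroup W V
    by (rule submodule_abelian_subgroup[OF assms(1)])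
  have "W +> x = W +> y \<longleftrightarrow> x \<in> W +> y"
    using assms W.a_rcos_self W.a_repr_independence' by metis
  then show ?thesis
    using mem_coset_iff assms by simp
qed

end

lemma quotient_space_simps [simp]:
  "carrier (quotient_space V W) = a_rcosets\<^bsub>V\<^esub> W" "\<zero>\<^bsub>quotient_space V W\<^esub> = W"
  "C \<oplus>\<^bsub>quotient_space V W\<^esub> D = C <+>\<^bsub>V\<^esub> D"
  "c \<odot>\<^bsub>quotient_space V W\<^esub> C = (\<Union>x\<in>C. W +>\<^bsub>V\<^esub> (c \<odot>\<^bsub>V\<^esub> x))"
  by (simp_all add: quotient_space_def)

context HA_module
begin

text \<open>No i satisfies 0 < i and i + j = 0, so the generating set is empty.\<close>

lemma augmentation_part_0: "augmentation_part E 0 = {\<zero>\<^bsub>piece E 0\<^esub>}"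
proof -
  interpret E: F2_module "piece E k" for k
    using mod by blast
  have "subspace_span (piece E 0) {} \<subseteq> {\<zero>\<^bsub>piece E 0\<^esub>}"
    by (intro subspace_span_least E.submoduleI_F2) auto
  moreover have "\<zero>\<^bsub>piece E 0\<^esub> \<in> subspace_span (piece E 0) {}"
    by (intro submodule_zero subspace_span_submodule mod) auto
  ultimately show ?thesis
    by (auto simp: augmentation_part_def)
qed

text \<open>A product by t^i with i > 0 is t times a product by t^(i-1), and t E^n is already a
  subspace, so taking the span adds nothing.\<close>

lemma augmentation_part_Suc: "augmentation_part E (Suc n) = T 1 n ` carrier (piece E n)"
proof
  interpret E: F2_module "piece E k" for k
    using mod by blast
  let ?S = "{act E i j h x | i j h x.
      0 < i \<and> i + j = Suc n \<and> h \<in> carrier (piece HH i) \<and> x \<in> carrier (piece E j)}"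
  have cl: "T 1 n x \<in> carrier (piece E (Suc n))" if "x \<in> carrier (piece E n)" for x
    using T_closed[OF that, of 1] by simp
  have "submodule (T 1 n ` carrier (piece E n)) F2 (piece E (Suc n))"
  proof (rule E.submoduleI_F2)
    show "\<zero>\<^bsub>piece E (Suc n)\<^esub> \<in> T 1 n ` carrier (piece E n)"
      using T_zero[of 1 n] by (intro image_eqI[where x = "\<zero>\<^bsub>piece E n\<^esub>"]) auto
    fix u v assume "u \<in> T 1 n ` carrier (piece E n)" "v \<in> T 1 n ` carrier (piece E n)"
    then obtain a b where "a \<in> carrier (piece E n)" "b \<in> carrier (piece E n)" "u = T 1 n a" "v = T 1 n b"
      by blast
    then show "u \<oplus>\<^bsub>piece E (Suc n)\<^esub> v \<in> T 1 n ` carrier (piece E n)"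
      using linear_map_add[OF T_linear, of a n b 1] by (intro image_eqI[where x = "a \<oplus>\<^bsub>piece E n\<^esub> b"]) auto
  qed (use cl in auto)
  moreover have "?S \<subseteq> T 1 n ` carrier (piece E n)"
  proof clarify
    fix i j h x
    assume *: "0 < i" "i + j = Suc n" "h \<in> carrier (piece HH i)" "x \<in> carrier (piece E j)"
    then have idx: "i - 1 + j = n" "1 + (i - 1) = i"
      by auto
    define c where "c = coeff h i"
    have u: "T (i - 1) j x \<in> carrier (piece E n)"
      using T_closed[OF *(4), of "i - 1"] unfolding idx .
    have "act E i j h x = c \<odot>\<^bsub>piece E (Suc n)\<^esub> T 1 n (T (i - 1) j x)"
      using act_eq[OF *(4,3)] T_T[OF *(4), of 1 "i - 1"] unfolding idx *(2) c_def by simp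
    also have "\<dots> = T 1 n (c \<odot>\<^bsub>piece E n\<^esub> T (i - 1) j x)"
      using linear_map_smult[OF T_linear u, of 1 c] by simp
    finally show "act E i j h x \<in> T 1 n ` carrier (piece E n)"
      using u by auto
  qed
  ultimately show "augmentation_part E (Suc n) \<subseteq> T 1 n ` carrier (piece E n)"
    unfolding augmentation_part_def by (rule subspace_span_least)
  have "T 1 n x \<in> ?S" if "x \<in> carrier (piece E n)" for x
    using that tt_carrier(1)[of 1] unfolding T_def by (intro CollectI exI conjI) auto
  then have "T 1 n ` carrier (piece E n) \<subseteq> ?S"
    by (rule image_subsetI)
  also have "\<dots> \<subseteq> augmentation_part E (Suc n)"
    unfolding augmentation_part_def by (rule subspace_span_superset)
  finally show "T 1 n ` carrier (piece E n) \<subseteq> augmentation_part E (Suc n)" .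
qed

lemma augmentation_part_submodule: "submodule (augmentation_part E n) F2 (piece E n)"
  unfolding augmentation_part_def
proof (rule subspace_span_submodule[OF mod])
  show "{act E i j h x | i j h x.
      0 < i \<and> i + j = n \<and> h \<in> carrier (piece HH i) \<and> x \<in> carrier (piece E j)} \<subseteq> carrier (piece E n)"
    by (clarify, rule linear_map_closed[OF HA_moduleD(2)[OF HA]])
qed

text \<open>The composite \<open>q\<close> of the projection to the reduction with the isomorphism
  to \<open>J\<close> is onto, and its kernel is the augmentation part, which is t E^n in degree n +
  1. Comparison with the known pieces of \<open>J\<close> yields the assumptions of
  \<open>J2_type\<close>, with a lift of \<open>a\<close> as \<open>x\<close>.\<close>

lemma reduction_J2_type:
  fixes J :: "'u gmod"
  assumes free: "free_H_module E" and iso: "A_isomorphic (reduction E) J" and J: "unstable_module J"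
    and J0: "carrier (piece J 0) = {\<zero>\<^bsub>piece J 0\<^esub>}"
    and J1: "carrier (piece J 1) = {\<zero>\<^bsub>piece J 1\<^esub>, a}" "a \<noteq> \<zero>\<^bsub>piece J 1\<^esub>"
    and J2: "carrier (piece J 2) = {\<zero>\<^bsub>piece J 2\<^esub>, Sq J 1 1 a}" "Sq J 1 1 a \<noteq> \<zero>\<^bsub>piece J 2\<^esub>"
    and J3: "\<And>n. 3 \<le> n \<Longrightarrow> carrier (piece J n) = {\<zero>\<^bsub>piece J n\<^esub>}"
  shows "\<exists>x. J2_type E x"
proof -
  interpret E: F2_module "piece E k" for k
    using mod by blast
  interpret J: F2_module "piece J k" for k
    using unstable_moduleD(1)[OF J] by blast
  let ?W = "augmentation_part E"
  note W = augmentation_part_submodule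
  obtain f where f: "A_map (reduction E) J f"
    and bij: "\<And>n. bij_betw (f n) (carrier (piece (reduction E) n)) (carrier (piece J n))"
    using iso unfolding A_isomorphic_def by blast
  have R: "piece (reduction E) n = quotient_space (piece E n) (?W n)" for n
    by (simp add: reduction_def quotient_hmod_def)
  have f_lin: "linear_map (quotient_space (piece E n) (?W n)) (piece J n) (f n)" for n
    using f unfolding A_map_def R by blast
  have coset: "(?W n +>\<^bsub>piece E n\<^esub> x) \<in> carrier (piece (reduction E) n)" if "x \<in> carrier (piece E n)" for n x
    unfolding R using that E.a_rcosetsI[OF E.submoduleE(1)[OF W]] by simp
  define q where "q n x = f n (?W n +>\<^bsub>piece E n\<^esub> x)" for n x
  have q_closed: "q n x \<in> carrier (piece J n)" if "x \<in> carrier (piece E n)" for n x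
    unfolding q_def using bij_betwE[OF bij] coset[OF that] by blast
  have q_eq: "q n x = q n z \<longleftrightarrow> x \<oplus>\<^bsub>piece E n\<^esub> z \<in> ?W n"
    if "x \<in> carrier (piece E n)" "z \<in> carrier (piece E n)" for n x z
    unfolding q_def using inj_on_eq_iff[OF bij_betw_imp_inj_on[OF bij] coset[OF that(1)] coset[OF that(2)]]
      E.coset_eq_iff[OF W that] by simp
  have q_surj: "\<exists>x\<in>carrier (piece E n). q n x = j" if "j \<in> carrier (piece J n)" for n j
  proof -
    have "j \<in> f n ` carrier (piece (reduction E) n)"
      using bij_betw_imp_surj_on[OF bij] that by blast
    then obtain C where C: "C \<in> a_rcosets\<^bsub>piece E n\<^esub> ?W n" "j = f n C"
      unfolding R by auto
    then show ?thesis
      unfolding A_RCOSETS_def' q_def by blast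
  qed
  have q_0: "q n \<zero>\<^bsub>piece E n\<^esub> = \<zero>\<^bsub>piece J n\<^esub>" for n
  proof -
    interpret W: abelian_subgroup "?W n" "piece E n"
      by (rule E.submodule_abelian_subgroup[OF W])
    let ?Z = "?W n +>\<^bsub>piece E n\<^esub> \<zero>\<^bsub>piece E n\<^esub>"
    \<comment> \<open>The zero coset is idempotent under addition, so its image v satisfies v = v +
      v = 0.\<close>
    have "?Z <+>\<^bsub>piece E n\<^esub> ?Z = ?Z"
      using W.a_rcos_sum[of "\<zero>\<^bsub>piece E n\<^esub>" "\<zero>\<^bsub>piece E n\<^esub>"] by simp
    then have "q n \<zero>\<^bsub>piece E n\<^esub> \<oplus>\<^bsub>piece J n\<^esub> q n \<zero>\<^bsub>piece E n\<^esub> = q n \<zero>\<^bsub>piece E n\<^esub>"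
      using linear_map_add[OF f_lin, of ?Z n ?Z] coset[OF E.M.zero_closed, of n] unfolding q_def R by simp
    then show ?thesis
      using J.add_self[OF q_closed[OF E.M.zero_closed]] by simp
  qed
  have q_0_iff: "q n x = \<zero>\<^bsub>piece J n\<^esub> \<longleftrightarrow> x \<in> ?W n" if "x \<in> carrier (piece E n)" for n x
    using q_eq[OF that E.M.zero_closed] q_0 that by simp
  have E0: "carrier (piece E 0) = {\<zero>\<^bsub>piece E 0\<^esub>}"
  proof -
    have "x = \<zero>\<^bsub>piece E 0\<^esub>" if "x \<in> carrier (piece E 0)" for x
      using q_0_iff[OF that] q_closed[OF that] J0 augmentation_part_0 by auto
    then show ?thesis
      using E.M.zero_closed[of 0] by blast
  qed
  have W1: "?W 1 = {\<zero>\<^bsub>piece E 1\<^esub>}"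
    using augmentation_part_Suc[of 0] T_zero[of 1 0] by (simp add: E0)
  have W2: "?W 2 = T 1 1 ` carrier (piece E 1)"
    using augmentation_part_Suc[of 1] by (simp add: numeral_2_eq_2)
  obtain x where x: "x \<in> carrier (piece E 1)" "q 1 x = a"
    using q_surj[of a 1] J1 by auto
  have x0: "x \<noteq> \<zero>\<^bsub>piece E 1\<^esub>"
    using x q_0[of 1] J1(2) by auto
  have E1: "carrier (piece E 1) = {\<zero>\<^bsub>piece E 1\<^esub>, x}"
  proof -
    have "e = x" if e: "e \<in> carrier (piece E 1)" "e \<noteq> \<zero>\<^bsub>piece E 1\<^esub>" for e
    proof -
      have "q 1 e = a"
        using q_closed[OF e(1)] q_0_iff[OF e(1)] W1 J1 e(2) by auto
      then have "e \<oplus>\<^bsub>piece E 1\<^esub> x = \<zero>\<^bsub>piece E 1\<^esub>"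
        using q_eq[OF e(1) x(1)] x(2) W1 by simp
      then show ?thesis
        using E.add_eq_zero_iff e(1) x(1) by blast
    qed
    then show ?thesis
      using x(1) E.M.zero_closed[of 1] by blast
  qed
  define y where "y = Sq E 1 1 x"
  have y: "y \<in> carrier (piece E 2)"
    unfolding y_def using Sq_closed[OF x(1), of 1] by (simp add: numeral_2_eq_2)
  have q_y: "q 2 y = Sq J 1 1 a"
  proof -
    let ?C = "?W 1 +>\<^bsub>piece E 1\<^esub> x"
    \<comment> \<open>E^0 = 0 makes the augmentation part zero in degree 1, so the union defining
      Sq^1 on this coset has a single member.\<close>
    have "?C = {x}"
      unfolding W1 a_r_coset_def' using x(1) by simp
    then have "Sq (reduction E) 1 1 ?C = ?W 2 +>\<^bsub>piece E 2\<^esub> y"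
      by (simp add: reduction_def quotient_hmod_def y_def numeral_2_eq_2)
    moreover have "f (1 + 1) (Sq (reduction E) 1 1 ?C) = Sq J 1 1 (f 1 ?C)"
      using f coset[OF x(1)] unfolding A_map_def by blast
    ultimately show ?thesis
      using x(2) by (simp add: q_def numeral_2_eq_2)
  qed
  have not_multiple: "y \<notin> T 1 1 ` carrier (piece E 1)"
    using q_0_iff[OF y] q_y J2(2) W2 by simp
  have generates: "\<exists>z\<in>carrier (piece E 1). \<exists>c. e = T 1 1 z \<oplus>\<^bsub>piece E 2\<^esub> c \<odot>\<^bsub>piece E 2\<^esub> y"
    if e: "e \<in> carrier (piece E 2)" for e
  proof -
    \<comment> \<open>J^2 has two elements, so e maps to zero or to the image of y; c is 0 or 1
      accordingly.\<close>
    have "\<exists>c. e \<oplus>\<^bsub>piece E 2\<^esub> c \<odot>\<^bsub>piece E 2\<^esub> y \<in> ?W 2"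
    proof (cases "e \<in> ?W 2")
      case True
      then show ?thesis
        using e y by (intro exI[of _ 0]) (simp add: E.smult_bit)
    next
      case False
      then have "q 2 e = q 2 y"
        using q_0_iff[OF e] q_closed[OF e] J2 q_y by auto
      then show ?thesis
        using q_eq[OF e y] y by (intro exI[of _ 1]) (simp add: E.smult_bit)
    qed
    then obtain c z where z: "z \<in> carrier (piece E 1)" "e \<oplus>\<^bsub>piece E 2\<^esub> c \<odot>\<^bsub>piece E 2\<^esub> y = T 1 1 z"
      unfolding W2 by blast
    have "e = (e \<oplus>\<^bsub>piece E 2\<^esub> c \<odot>\<^bsub>piece E 2\<^esub> y) \<oplus>\<^bsub>piece E 2\<^esub> c \<odot>\<^bsub>piece E 2\<^esub> y"
      using e y by (simp add: E.M.a_assoc E.add_self)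
    then show ?thesis
      using z by auto
  qed
  have multiples: "carrier (piece E (Suc n)) = T 1 n ` carrier (piece E n)" if "2 \<le> n" for n
  proof -
    have "e \<in> ?W (Suc n)" if "e \<in> carrier (piece E (Suc n))" for e
      using q_0_iff[OF that] q_closed[OF that] J3[of "Suc n"] \<open>2 \<le> n\<close> by simp
    then show ?thesis
      using E.submoduleE(1)[OF W] augmentation_part_Suc[of n] by blast
  qed
  have "J2_type E x"
  proof (rule J2_type.intro[OF HA_module_axioms], rule J2_type_axioms.intro)
    show "x \<noteq> \<zero>\<^bsub>piece E 1\<^esub>" by (rule x0)
    show "carrier (piece E 0) = {\<zero>\<^bsub>piece E 0\<^esub>}" by (rule E0)
    show "carrier (piece E 1) = {\<zero>\<^bsub>piece E 1\<^esub>, x}" by (rule E1)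
    show "Sq E 1 1 x \<notin> T 1 1 ` carrier (piece E 1)" by (rule not_multiple[unfolded y_def])
  qed (fact generates[unfolded y_def] multiples free_torsion_free[OF free])+
  then show ?thesis ..
qed

end

section \<open>The submodule of \<open>H \<oplus> \<Sigma>H\<close>\<close>

text \<open>Coefficients in (1 + s)^n = (1 + s)^(n-1) (1 + s). This will match the squares of
  t^(n-1) x with those of t^n in H.\<close>

lemma pascal_diff:
  assumes "0 < n"
  shows "of_nat (n - 1 choose k) + (if k = 0 then 0 else of_nat (n - 1 choose (k - 1))) =
    (of_nat (n choose k) :: 'a :: comm_semiring_1)"
  using assms by (cases n; cases k) (simp_all add: add.commute)

text \<open>In characteristic 2, (1 + s)^n = (1 + s)^(n-2) (1 + s^2). This will match the squares of
  t^(n-2) y, where Sq^2 y = t^2 y, with those of t^n.\<close>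

lemma pascal_diff2:
  assumes "2 \<le> n" and char_2: "\<And>c :: 'a :: comm_semiring_1. c + c = 0"
  shows "of_nat (n - 2 choose k) + (if k < 2 then 0 else of_nat (n - 2 choose (k - 2))) =
    (of_nat (n choose k) :: 'a)"
proof -
  obtain m where n: "n = Suc (Suc m)"
    using assms(1) by (auto dest: le_Suc_ex)
  have z: "c + (c + d) = d" for c d :: 'a
    using char_2[of c] by (simp flip: add.assoc)
  consider "k = 0" | "k = 1" | j where "k = Suc (Suc j)"
    by (metis One_nat_def not0_implies_Suc)
  then show ?thesis
    by cases (simp_all add: n z ac_simps)
qed

lemma suspension_HH_simps [simp]:
  "v \<oplus>\<^bsub>piece (suspension HH) n\<^esub> w = v + w" "\<zero>\<^bsub>piece (suspension HH) n\<^esub> = 0"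
  "c \<odot>\<^bsub>piece (suspension HH) n\<^esub> v = Polynomial.smult c v"
  by (cases n; simp add: suspension_def suspension_piece_def HH_def vsp_def)+

lemma suspension_HH_carrier:
  "v \<in> carrier (piece (suspension HH) n) \<longleftrightarrow> v = 0 \<or> 0 < n \<and> v = tt ^ (n - 1)"
  by (cases n) (auto simp: suspension_def suspension_piece_def HH_carrier_iff)

abbreviation HSH :: "(bit poly \<times> bit poly) hmod"
  where "HSH \<equiv> direct_sum HH (suspension HH)"

lemma HSH_simps [simp]:
  "carrier (piece HSH n) = carrier (piece HH n) \<times> carrier (piece (suspension HH) n)"
  "v \<oplus>\<^bsub>piece HSH n\<^esub> w = v + w" "\<zero>\<^bsub>piece HSH n\<^esub> = 0"
  "c \<odot>\<^bsub>piece HSH n\<^esub> v = (Polynomial.smult c (fst v), Polynomial.smult c (snd v))"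
  by (simp_all add: direct_sum_def zero_prod_def plus_prod_def split: prod.split)

lemma Sq_HSH: "Sq HSH k n (u, v) = (Sq HH k n u, Sq (suspension HH) k n v)"
  by (simp add: direct_sum_def)

lemma act_HSH: "act HSH i n h (u, v) = (act HH i n h u, act (suspension HH) i n h v)"
  by (simp add: direct_sum_def)

lemma act_suspension_HH: "0 < n \<Longrightarrow> act (suspension HH) i n h v = h * v"
  by (cases n) (simp_all add: suspension_def act_HH)

lemma module_HSH: "module F2 (piece HSH n)"
  by (rule F2_moduleI_carrier)
    (auto simp: HH_carrier_iff suspension_HH_carrier zero_prod_def bit_poly_add_self add.assoc add.commute)

text \<open>The H-linear extension of the assignment on generators: t^(n-1) x goes to (t^n,
  \<Sigma>t^(n-1)) and t^(n-2) y to (t^n, 0). It respects Sq^1 x = y because Sq^1 t = t^2 and Sq^1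
  kills \<Sigma>1.\<close>

definition model_embed :: "nat \<Rightarrow> bit \<times> bit \<Rightarrow> bit poly \<times> bit poly"
  where "model_embed n v = (Polynomial.smult (fst v + snd v) (tt ^ n),
    if n = 0 then 0 else Polynomial.smult (fst v) (tt ^ (n - 1)))"

lemma model_embed_linear: "linear_map (piece (model \<beta>) n) (piece HSH n) (model_embed n)"
proof -
  have "Polynomial.smult c (tt ^ m) = 0 \<or> Polynomial.smult c (tt ^ m) = tt ^ m" for c m
    by (cases c) auto
  then have "model_embed n v \<in> carrier (piece HSH n)" for v
    by (auto simp: model_embed_def HH_carrier_iff suspension_HH_carrier)
  moreover have "model_embed n (v + w) = model_embed n v + model_embed n w" for v w
    by (simp only: model_embed_def plus_prod_def fst_conv snd_conv smult_add_left[symmetric] ac_simps split: if_split) simp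
  ultimately show ?thesis
    unfolding linear_map_iff[OF module_model module_HSH] by simp
qed

text \<open>In the first summand both generators become t^n, so the two Pascal identities combine to
  (n choose k)(p + q). In the suspended summand only p survives, with the coefficient of Sq^k
  t^(n-1).\<close>

lemma model_embed_Sq:
  assumes "v \<in> carrier (piece (model 1) n)"
  shows "model_embed (n + k) (Sq (model 1) k n v) = Sq HSH k n (model_embed n v)"
proof -
  obtain p q where v: "v = (p, q)"
    by fastforce
  define A B C :: bit where "A = of_nat (n - 1 choose k)"
    and "B = (if k = 0 then 0 else of_nat (n - 1 choose (k - 1)))"
    and "C = of_nat (n - 2 choose k) + (if k < 2 then 0 else of_nat (n - 2 choose (k - 2)))"
  have S: "Sq (model 1) k n v = (p * A, p * B + q * C)"
    by (simp only: model_def hmod.simps gmod.simps v A_def B_def C_def prod.case mult_1)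
  have "p * A + (p * B + q * C) = of_nat (n choose k) * (p + q)"
  proof -
    have "p * (A + B) = p * of_nat (n choose k)"
      using assms pascal_diff[of n k, where 'a = bit] unfolding A_def B_def v by (cases "n = 0") auto
    moreover have "q * C = q * of_nat (n choose k)"
      using assms pascal_diff2[of n k, OF _ bit_add_self] unfolding C_def v by (cases "n < 2") auto
    ultimately show ?thesis
      by (simp only: distrib_left distrib_right add.assoc[symmetric] mult.commute)
  qed
  moreover have "Sq (suspension HH) k n (if n = 0 then 0 else Polynomial.smult p (tt ^ (n - 1))) =
      (if n + k = 0 then 0 else Polynomial.smult (p * A) (tt ^ (n + k - 1)))"
  proof (cases n)
    case 0
    then have "p = 0"
      using assms by (simp add: v)
    then show ?thesis
      using 0 suspension_HH_simps(2)[of k] by (simp add: suspension_def)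
  next
    case (Suc m)
    then show ?thesis
      by (simp add: suspension_def Sq_HH A_def power_add mult.commute del: bit_not_zero_iff)
  qed
  ultimately show ?thesis
    unfolding v S[unfolded v] Sq_HSH model_embed_def fst_conv snd_conv
    by (simp add: Sq_HH power_add mult.commute del: add_bit_eq_xor mult_bit_eq_and)
qed

lemma model_embed_act:
  assumes "v \<in> carrier (piece (model 1) n)" "h \<in> carrier (piece HH i)"
  shows "model_embed (i + n) (act (model 1) i n h v) = act HSH i n h (model_embed n v)"
proof -
  obtain p q where v: "v = (p, q)"
    by fastforce
  define c where "c = coeff h i"
  have h: "h = Polynomial.smult c (tt ^ i)"
    unfolding c_def by (rule HH_carrierE[OF assms(2)])
  have S: "act (model 1) i n h v = (c * p, c * q)"
    by (simp add: model_def v c_def)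
  have "act (suspension HH) i n h (if n = 0 then 0 else Polynomial.smult p (tt ^ (n - 1))) =
      (if i + n = 0 then 0 else Polynomial.smult (c * p) (tt ^ (i + n - 1)))"
  proof (cases n)
    case 0
    then have "p = 0"
      using assms by (simp add: v)
    then show ?thesis
      using 0 suspension_HH_simps(2)[of i] by (simp add: suspension_def)
  next
    case (Suc m)
    then show ?thesis
      by (simp add: suspension_def act_HH h power_add mult.commute)
  qed
  then show ?thesis
    unfolding v S[unfolded v] act_HSH model_embed_def fst_conv snd_conv
    by (simp add: act_HH h power_add distrib_left[symmetric] mult.commute del: add_bit_eq_xor mult_bit_eq_and)
qed

text \<open>The suspended coordinate recovers p in positive degrees, after which the first one
  recovers q; in degree 0 the model is zero.\<close>

lemma model_embed_inj: "inj_on (model_embed n) (carrier (piece (model \<beta>) n))"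
proof (rule linear_map_inj_on[OF module_model module_HSH model_embed_linear])
  fix v assume v: "v \<in> carrier (piece (model \<beta>) n)" "model_embed n v = \<zero>\<^bsub>piece HSH n\<^esub>"
  then have "n = 0 \<or> fst v = 0" "fst v + snd v = 0"
    by (auto simp: model_embed_def zero_prod_def tt_power_eq_monom smult_monom split: if_splits)
  then show "v = \<zero>\<^bsub>piece (model \<beta>) n\<^esub>"
    using v by (auto simp: prod_eq_iff)
qed

lemma linear_image_submodule:
  assumes "module F2 V" "module F2 W" "linear_map V W f"
  shows "submodule (f ` carrier V) F2 W"
proof -
  interpret V: F2_module V using assms by blast
  interpret W: F2_module W using assms by blast
  show ?thesis
  proof (rule W.submoduleI_F2)
    show "f ` carrier V \<subseteq> carrier W"
      using linear_map_closed[OF assms(3)] by (rule image_subsetI)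
    show "\<zero>\<^bsub>W\<^esub> \<in> f ` carrier V"
      using linear_map_zero[OF assms] V.M.zero_closed by (metis imageI)
    fix u v assume "u \<in> f ` carrier V" "v \<in> f ` carrier V"
    then obtain a b where "a \<in> carrier V" "b \<in> carrier V" "u = f a" "v = f b"
      by blast
    then show "u \<oplus>\<^bsub>W\<^esub> v \<in> f ` carrier V"
      using linear_map_add[OF assms(3)] V.M.a_closed by (metis imageI)
  qed
qed

text \<open>The image is closed under all operations and contains both generators, so it contains
  what they generate. Conversely, a submodule with these elements contains their multiples by
  t^(n-1) and t^(n-2), namely (t^n, \<Sigma>t^(n-1)) and (t^n, 0), which span the image in degree
  n.\<close>

lemma model_embed_image:
  "carrier (piece (generated_HA_submodule HSH {(1, (tt, 1)), (2, (tt ^ 2, 0))}) n) =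
    model_embed n ` carrier (piece (model 1) n)"
proof -
  let ?I = "\<lambda>n. model_embed n ` carrier (piece (model 1) n)"
  let ?gen = "\<lambda>S. \<forall>(d, x)\<in>{(1, (tt, 1)), (2, (tt ^ 2, 0))}. x \<in> S d"
  have I_sub: "sub_HA_module ?I HSH"
    unfolding sub_HA_module_def
  proof (intro conjI allI ballI)
    show "submodule (?I n) F2 (piece HSH n)" for n
      by (rule linear_image_submodule[OF module_model module_HSH model_embed_linear])
    show "Sq HSH k n x \<in> ?I (n + k)" if "x \<in> ?I n" for k n x
    proof -
      obtain v where v: "v \<in> carrier (piece (model 1) n)" "x = model_embed n v"
        using \<open>x \<in> ?I n\<close> by blast
      show ?thesis
        unfolding v(2) model_embed_Sq[OF v(1), symmetric] by (intro imageI model_Sq_closed v)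
    qed
    show "act HSH i n h x \<in> ?I (i + n)" if "h \<in> carrier (piece HH i)" "x \<in> ?I n" for i n h x
    proof -
      obtain v where v: "v \<in> carrier (piece (model 1) n)" "x = model_embed n v"
        using \<open>x \<in> ?I n\<close> by blast
      show ?thesis
        unfolding v(2) model_embed_act[OF v(1) that(1), symmetric] by (intro imageI model_act_closed v)
    qed
  qed
  have I_gen: "?gen ?I"
  proof -
    have "(tt, 1) = model_embed 1 (1, 0)" "(tt ^ 2, 0) = model_embed 2 (0, 1)"
      by (simp_all add: model_embed_def)
    then show ?thesis
      by (auto intro!: image_eqI)
  qed
  have I_least: "?I n \<subseteq> S n" if S: "sub_HA_module S HSH" and gen: "?gen S" for S
  proof
    fix x assume "x \<in> ?I n"
    then obtain p q where v: "(p, q) \<in> carrier (piece (model 1) n)" "x = model_embed n (p, q)"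
      by (metis imageE surj_pair)
    interpret F2_module "piece HSH n"
      using module_HSH by blast
    note S' = submoduleE[OF S[unfolded sub_HA_module_def, THEN conjunct1, rule_format]]
    have act: "act HSH i m (tt ^ i) x \<in> S (i + m)" if "x \<in> S m" for i m x
      using S that tt_carrier(1) unfolding sub_HA_module_def by blast
    have "(0, 0) \<in> S n"
      using submodule_zero[OF S[unfolded sub_HA_module_def, THEN conjunct1, rule_format], of n]
      by (simp add: zero_prod_def)
    moreover have "(tt ^ n, tt ^ (n - 1)) \<in> S n" if "1 \<le> n"
    proof -
      have "tt ^ n = tt ^ (n - 1) * tt"
        using that by (simp only: power_minus_mult)
      then show ?thesis
        using act[of "(tt, 1)" 1 "n - 1"] gen that by (simp add: act_HSH act_HH act_suspension_HH)
    qed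
    moreover have "(tt ^ n, 0) \<in> S n" if "2 \<le> n"
    proof -
      have "tt ^ n = tt ^ (n - 2) * tt ^ 2"
        using that by (simp only: power_add[symmetric] le_add_diff_inverse2)
      then show ?thesis
        using act[of "(tt ^ 2, 0)" 2 "n - 2"] gen that
        by (simp add: act_HSH act_HH act_suspension_HH del: add_2_eq_Suc')
    qed
    ultimately have "(Polynomial.smult p (tt ^ n), Polynomial.smult p (tt ^ (n - 1))) \<in> S n"
      "(Polynomial.smult q (tt ^ n), 0) \<in> S n"
      using v(1) by (cases p; cases q; simp add: not_less)+
    from S'(5)[OF this] have "(Polynomial.smult p (tt ^ n), Polynomial.smult p (tt ^ (n - 1))) +
        (Polynomial.smult q (tt ^ n), 0) \<in> S n"
      by simp
    also have "(Polynomial.smult p (tt ^ n), Polynomial.smult p (tt ^ (n - 1))) +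
        (Polynomial.smult q (tt ^ n), 0) = x"
      using v by (cases "n = 0") (simp_all add: model_embed_def smult_add_left del: add_bit_eq_xor)
    finally show "x \<in> S n" .
  qed
  have "carrier (piece (generated_HA_submodule HSH {(1, (tt, 1)), (2, (tt ^ 2, 0))}) n) =
      \<Inter>{S n | S. sub_HA_module S HSH \<and> ?gen S}"
    by (simp add: generated_HA_submodule_def del: HSH_simps)
  also have "\<dots> = ?I n"
  proof (rule subset_antisym)
    show "\<Inter>{S n | S. sub_HA_module S HSH \<and> ?gen S} \<subseteq> ?I n"
      using I_sub I_gen by (intro Inter_lower CollectI exI[of _ ?I] conjI refl)
    show "?I n \<subseteq> \<Inter>{S n | S. sub_HA_module S HSH \<and> ?gen S}"
    proof (rule Inter_greatest)
      fix K assume "K \<in> {S n | S. sub_HA_module S HSH \<and> ?gen S}"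
      then obtain S where "K = S n" "sub_HA_module S HSH" "?gen S"
        by (elim CollectE exE conjE) rule
      then show "?I n \<subseteq> K"
        using I_least by simp
    qed
  qed
  finally show ?thesis .
qed

lemma model_generated:
  shows "HA_map (model 1) (generated_HA_submodule HSH {(1, (tt, 1)), (2, (tt ^ 2, 0))}) model_embed"
    and "bij_betw (model_embed n) (carrier (piece (model 1) n))
      (carrier (piece (generated_HA_submodule HSH {(1, (tt, 1)), (2, (tt ^ 2, 0))}) n))"
proof -
  let ?G = "generated_HA_submodule HSH {(1, (tt, 1)), (2, (tt ^ 2, 0))}"
  show "bij_betw (model_embed n) (carrier (piece (model 1) n)) (carrier (piece ?G n))" for n
    unfolding model_embed_image using model_embed_inj by (rule inj_on_imp_bij_betw)
  have "linear_map (piece (model 1) n) (piece ?G n) (model_embed n)" for n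
  proof -
    have "v \<oplus>\<^bsub>piece ?G n\<^esub> w = v \<oplus>\<^bsub>piece HSH n\<^esub> w" "c \<odot>\<^bsub>piece ?G n\<^esub> v = c \<odot>\<^bsub>piece HSH n\<^esub> v" for v w c
      by (simp_all add: generated_HA_submodule_def del: HSH_simps)
    then show ?thesis
      using model_embed_linear[of 1 n] model_embed_image[of n]
      unfolding linear_map_def hom_def by (auto simp del: HSH_simps model_simps)
  qed
  moreover have "Sq ?G = Sq HSH" "act ?G = act HSH"
    by (simp_all add: generated_HA_submodule_def)
  ultimately show "HA_map (model 1) ?G model_embed"
    unfolding HA_map_def A_map_def using model_embed_Sq model_embed_act by metis
qed

section \<open>The tensor product \<open>H \<otimes> J(2)\<close>\<close>

text \<open>The first isomorphism theorem, with the isomorphism directed out of \<open>C\<close> as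
  the comparison through the model requires: it sends v to the fibre of \<open>\<phi>\<close> over
  v, which is a coset of \<open>W\<close>.\<close>

lemma quotient_hmod_isomorphism:
  fixes L :: "'l hmod" and C :: "'c hmod"
  assumes L: "\<And>n. module F2 (piece L n)"
    "\<And>k n p. p \<in> carrier (piece L n) \<Longrightarrow> Sq L k n p \<in> carrier (piece L (n + k))"
    "\<And>i n h p. h \<in> carrier (piece HH i) \<Longrightarrow> p \<in> carrier (piece L n) \<Longrightarrow> act L i n h p \<in> carrier (piece L (i + n))"
    and C: "\<And>n. module F2 (piece C n)"
    and W: "\<And>n. submodule (W n) F2 (piece L n)"
    and \<phi>: "\<And>n. linear_map (piece L n) (piece C n) (\<phi> n)"
    "\<And>k n p. p \<in> carrier (piece L n) \<Longrightarrow> \<phi> (n + k) (Sq L k n p) = Sq C k n (\<phi> n p)"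
    "\<And>i n h p. h \<in> carrier (piece HH i) \<Longrightarrow> p \<in> carrier (piece L n) \<Longrightarrow>
      \<phi> (i + n) (act L i n h p) = act C i n h (\<phi> n p)"
    and surj: "\<And>n. \<phi> n ` carrier (piece L n) = carrier (piece C n)"
    and ker: "\<And>n p. p \<in> carrier (piece L n) \<Longrightarrow> \<phi> n p = \<zero>\<^bsub>piece C n\<^esub> \<longleftrightarrow> p \<in> W n"
  shows "\<exists>f. HA_map C (quotient_hmod L W) f \<and>
    (\<forall>n. bij_betw (f n) (carrier (piece C n)) (carrier (piece (quotient_hmod L W) n)))"
proof -
  interpret L: F2_module "piece L k" for k
    using L(1) by blast
  interpret C: F2_module "piece C k" for k
    using C by blast
  define f where "f n v = {p \<in> carrier (piece L n). \<phi> n p = v}" for n v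
  have f_coset: "f n (\<phi> n p) = W n +>\<^bsub>piece L n\<^esub> p" if p: "p \<in> carrier (piece L n)" for n p
  proof (rule Set.set_eqI)
    fix u
    have sub: "(W n +>\<^bsub>piece L n\<^esub> p) \<subseteq> carrier (piece L n)"
      using L.a_r_coset_subset_G[OF L.submoduleE(1)[OF W] p] .
    show "u \<in> f n (\<phi> n p) \<longleftrightarrow> u \<in> W n +>\<^bsub>piece L n\<^esub> p"
    proof (cases "u \<in> carrier (piece L n)")
      case True
      have "\<phi> n u = \<phi> n p \<longleftrightarrow> \<phi> n (u \<oplus>\<^bsub>piece L n\<^esub> p) = \<zero>\<^bsub>piece C n\<^esub>"
        using linear_map_closed[OF \<phi>(1)] True p
        by (simp add: linear_map_add[OF \<phi>(1)] C.add_eq_zero_iff)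
      also have "\<dots> \<longleftrightarrow> u \<oplus>\<^bsub>piece L n\<^esub> p \<in> W n"
        using True p by (intro ker) simp
      finally show ?thesis
        using True p by (simp add: f_def L.mem_coset_iff[OF W])
    next
      case False
      then show ?thesis
        using sub by (auto simp: f_def)
    qed
  qed
  have rep: "\<exists>p\<in>carrier (piece L n). v = \<phi> n p" if "v \<in> carrier (piece C n)" for v n
    using that surj[of n] by (metis imageE)
  have Q: "piece (quotient_hmod L W) n = quotient_space (piece L n) (W n)" for n
    by (simp add: quotient_hmod_def)
  \<comment> \<open>Operations on the quotient are unions over a coset. Their members agree once
    they depend on u only through \<open>\<phi> n u\<close>, so one representative p computes the
    union.\<close>
  have union: "(\<Union>u\<in>f n (\<phi> n p). F u) = F p"
    if "p \<in> carrier (piece L n)" "\<And>u. u \<in> carrier (piece L n) \<Longrightarrow> \<phi> n u = \<phi> n p \<Longrightarrow> F u = F p"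
    for n p and F :: "'l \<Rightarrow> 'l set"
    by (intro UN_constant_eq[where a = p] ballI that(2)) (simp_all add: f_def that(1))
  have f_smult: "f n (c \<odot>\<^bsub>piece C n\<^esub> v) = c \<odot>\<^bsub>quotient_space (piece L n) (W n)\<^esub> f n v"
    if "v \<in> carrier (piece C n)" for n c v
  proof -
    obtain p where p: "p \<in> carrier (piece L n)" "v = \<phi> n p"
      using rep[OF \<open>v \<in> carrier (piece C n)\<close>] by (elim bexE) rule
    have *: "W n +>\<^bsub>piece L n\<^esub> (c \<odot>\<^bsub>piece L n\<^esub> u) = f n (c \<odot>\<^bsub>piece C n\<^esub> \<phi> n u)"
      if "u \<in> carrier (piece L n)" for u
      using f_coset[of "c \<odot>\<^bsub>piece L n\<^esub> u" n] that by (simp add: linear_map_smult[OF \<phi>(1)])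
    show ?thesis
      unfolding quotient_space_simps p(2) using p(1) * by (intro trans[OF _ union[symmetric]]) auto
  qed
  have f_add: "f n (v \<oplus>\<^bsub>piece C n\<^esub> w) = f n v <+>\<^bsub>piece L n\<^esub> f n w"
    if vw: "v \<in> carrier (piece C n)" "w \<in> carrier (piece C n)" for n v w
  proof -
    obtain p q where p: "p \<in> carrier (piece L n)" "v = \<phi> n p" and q: "q \<in> carrier (piece L n)" "w = \<phi> n q"
      using rep[OF vw(1)] rep[OF vw(2)] by (elim bexE) rule
    interpret W: abelian_subgroup "W n" "piece L n"
      by (rule L.submodule_abelian_subgroup[OF W])
    show ?thesis
      using p q f_coset[of "p \<oplus>\<^bsub>piece L n\<^esub> q" n] W.a_rcos_sum[of p q]
      by (simp add: f_coset linear_map_add[OF \<phi>(1)])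
  qed
  have f_closed: "f n v \<in> carrier (quotient_space (piece L n) (W n))" if "v \<in> carrier (piece C n)" for n v
    using rep[OF that] f_coset[of _ n] by (auto simp: A_RCOSETS_def')
  have "linear_map (piece C n) (quotient_space (piece L n) (W n)) (f n)" for n
    unfolding linear_map_def hom_def using f_closed f_add f_smult by auto
  moreover have "f (n + k) (Sq C k n v) = Sq (quotient_hmod L W) k n (f n v)"
    if "v \<in> carrier (piece C n)" for k n v
  proof -
    obtain p where p: "p \<in> carrier (piece L n)" "v = \<phi> n p"
      using rep[OF \<open>v \<in> carrier (piece C n)\<close>] by (elim bexE) rule
    have *: "W (n + k) +>\<^bsub>piece L (n + k)\<^esub> Sq L k n u = f (n + k) (Sq C k n (\<phi> n u))"
      if "u \<in> carrier (piece L n)" for u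
      using f_coset[OF L(2)[OF that], of k] \<phi>(2)[OF that] by simp
    have "Sq (quotient_hmod L W) k n (f n v) = (\<Union>u\<in>f n (\<phi> n p). W (n + k) +>\<^bsub>piece L (n + k)\<^esub> Sq L k n u)"
      by (simp add: quotient_hmod_def p(2))
    also have "\<dots> = W (n + k) +>\<^bsub>piece L (n + k)\<^esub> Sq L k n p"
      using p(1) * by (intro union) auto
    finally show ?thesis
      using * p by simp
  qed
  moreover have "f (i + n) (act C i n h v) = act (quotient_hmod L W) i n h (f n v)"
    if h: "h \<in> carrier (piece HH i)" and "v \<in> carrier (piece C n)" for i n h v
  proof -
    obtain p where p: "p \<in> carrier (piece L n)" "v = \<phi> n p"
      using rep[OF \<open>v \<in> carrier (piece C n)\<close>] by (elim bexE) rule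
    have *: "W (i + n) +>\<^bsub>piece L (i + n)\<^esub> act L i n h u = f (i + n) (act C i n h (\<phi> n u))"
      if "u \<in> carrier (piece L n)" for u
      using f_coset[OF L(3)[OF h that]] \<phi>(3)[OF h that] by simp
    have "act (quotient_hmod L W) i n h (f n v) = (\<Union>u\<in>f n (\<phi> n p). W (i + n) +>\<^bsub>piece L (i + n)\<^esub> act L i n h u)"
      by (simp add: quotient_hmod_def p(2))
    also have "\<dots> = W (i + n) +>\<^bsub>piece L (i + n)\<^esub> act L i n h p"
      using p(1) * by (intro union) auto
    finally show ?thesis
      using * p by simp
  qed
  ultimately have "HA_map C (quotient_hmod L W) f"
    unfolding HA_map_def A_map_def Q by blast
  moreover have "bij_betw (f n) (carrier (piece C n)) (carrier (piece (quotient_hmod L W) n))" for n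
    unfolding bij_betw_def
  proof
    show "inj_on (f n) (carrier (piece C n))"
    proof (rule inj_onI)
      fix v w assume "v \<in> carrier (piece C n)" "f n v = f n w"
      with rep[of v n] show "v = w"
        unfolding f_def by blast
    qed
    have "D \<in> f n ` carrier (piece C n)" if "D \<in> a_rcosets\<^bsub>piece L n\<^esub> (W n)" for D
      using that f_coset[of _ n] linear_map_closed[OF \<phi>(1)] unfolding A_RCOSETS_def' by fast
    then show "f n ` carrier (piece C n) = carrier (piece (quotient_hmod L W) n)"
      unfolding Q using f_closed[of _ n] by auto
  qed
  ultimately show ?thesis
    by blast
qed

text \<open>A formal sum over \<open>bit\<close> is a finite set of keys, each with coefficient 1,
  so this is the linear extension of \<open>w\<close> when the values of \<open>w\<close> satisfy v
  + v = 0.\<close>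

definition keys_sum :: "('k \<Rightarrow> 'b :: ab_group_add) \<Rightarrow> ('k \<Rightarrow>\<^sub>0 bit) \<Rightarrow> 'b"
  where "keys_sum w p = (\<Sum>k\<in>Poly_Mapping.keys p. w k)"

lemma lookup_keys_bit: "k \<in> Poly_Mapping.keys p \<Longrightarrow> Poly_Mapping.lookup p k = (1 :: bit)"
  by (simp add: in_keys_iff)

text \<open>A key shared by p and q disappears from p + q, and w k + w k = 0 accounts for the
  loss.\<close>

lemma keys_sum_add:
  assumes "\<And>k. w k + w k = 0"
  shows "keys_sum w (p + q) = keys_sum w p + keys_sum w q"
proof -
  let ?f = "\<lambda>k (c :: bit). if c = 0 then 0 else w k"
  have f: "?f k (c + d) = ?f k c + ?f k d" for k c d
    using assms[of k] by (cases c; cases d) simp_all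
  have *: "keys_sum w r = (\<Sum>k\<in>Poly_Mapping.keys r. ?f k (Poly_Mapping.lookup r k))" for r
    unfolding keys_sum_def by (intro sum.cong) (simp_all add: lookup_keys_bit)
  show ?thesis
    unfolding * by (rule setsum_keys_plus_distrib[where f = ?f]) (simp, rule f)
qed

lemma keys_sum_0: "keys_sum w 0 = 0"
  by (simp add: keys_sum_def)

lemma keys_sum_single: "keys_sum w (Poly_Mapping.single k 1) = w k"
  by (simp add: keys_sum_def)

lemma keys_sum_sum:
  assumes "\<And>k. w k + w k = 0"
  shows "keys_sum w (\<Sum>i\<in>A. g i) = (\<Sum>i\<in>A. keys_sum w (g i))"
  by (induction A rule: infinite_finite_induct) (simp_all add: keys_sum_0 keys_sum_add[OF assms])

lemma sum_single_keys: "(\<Sum>k\<in>Poly_Mapping.keys p. Poly_Mapping.single k 1) = (p :: 'k \<Rightarrow>\<^sub>0 bit)"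
proof (rule poly_mapping_eqI)
  fix k
  have "Poly_Mapping.lookup (\<Sum>k\<in>Poly_Mapping.keys p. Poly_Mapping.single k 1) k =
      (\<Sum>j\<in>Poly_Mapping.keys p. if k = j then 1 else 0)"
    unfolding lookup_sum by (intro sum.cong) (auto simp: lookup_single when_def)
  also have "\<dots> = Poly_Mapping.lookup p k"
    by (simp add: sum.delta in_keys_iff)
  finally show "Poly_Mapping.lookup (\<Sum>k\<in>Poly_Mapping.keys p. Poly_Mapping.single k 1) k = Poly_Mapping.lookup p k" .
qed

lemma poly_mapping_bit_add_self: "p + p = (0 :: 'k \<Rightarrow>\<^sub>0 bit)"
  by (rule poly_mapping_eqI) (simp only: lookup_add lookup_zero bit_add_self)

lemma poly_mapping_bit_diff: "p - q = p + (q :: 'k \<Rightarrow>\<^sub>0 bit)"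
  by (simp add: diff_eq_eq add.assoc poly_mapping_bit_add_self)

lemma map_bit_mult: "Poly_Mapping.map ((*) c) p = (if c = 0 then 0 else (p :: 'k \<Rightarrow>\<^sub>0 bit))"
  by (cases c) (auto intro!: poly_mapping_eqI simp: Poly_Mapping.map.rep_eq when_def)

section \<open>The free space on pure tensors and its map to the model\<close>

context
  fixes J :: "'u gmod" and a :: 'u
  assumes J: "unstable_module J"
    and J0: "carrier (piece J 0) = {\<zero>\<^bsub>piece J 0\<^esub>}"
    and J1: "carrier (piece J 1) = {\<zero>\<^bsub>piece J 1\<^esub>, a}" "a \<noteq> \<zero>\<^bsub>piece J 1\<^esub>"
    and J2: "carrier (piece J 2) = {\<zero>\<^bsub>piece J 2\<^esub>, Sq J 1 1 a}" "Sq J 1 1 a \<noteq> \<zero>\<^bsub>piece J 2\<^esub>"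
    and J3: "\<And>n. 3 \<le> n \<Longrightarrow> carrier (piece J n) = {\<zero>\<^bsub>piece J n\<^esub>}"
begin

text \<open>For d = 1, 2 this is the nonzero functional on J^d, extended by zero to the other
  degrees; testing for zero suffices because J^d has two elements.\<close>

definition J_coord :: "nat \<Rightarrow> nat \<Rightarrow> 'u \<Rightarrow> bit"
  where "J_coord d m y = (if m = d \<and> y \<noteq> \<zero>\<^bsub>piece J m\<^esub> then 1 else 0)"

text \<open>The model coordinates of a pure tensor: t^i \<otimes> a has (1, 0) and t^i \<otimes>
  Sq^1 a has (0, 1).\<close>

definition weight :: "nat \<Rightarrow> nat \<times> bit poly \<times> 'u \<Rightarrow> bit \<times> bit"
  where "weight n k = (case k of (i, h, y) \<Rightarrow>
    (coeff h i * J_coord 1 (n - i) y, coeff h i * J_coord 2 (n - i) y))"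

definition valid_key :: "nat \<Rightarrow> nat \<times> bit poly \<times> 'u \<Rightarrow> bool"
  where "valid_key n k = (case k of (i, h, y) \<Rightarrow> i \<le> n \<and> h \<in> carrier (piece HH i) \<and> y \<in> carrier (piece J (n - i)))"

interpretation J: F2_module "piece J k" for k
  using unstable_moduleD(1)[OF J] by blast

abbreviation P :: "(nat \<times> bit poly \<times> 'u \<Rightarrow>\<^sub>0 bit) hmod"
  where "P \<equiv> pre_tensor HH J"

lemma J_zero_unless: "y \<in> carrier (piece J m) \<Longrightarrow> m \<noteq> 1 \<Longrightarrow> m \<noteq> 2 \<Longrightarrow> y = \<zero>\<^bsub>piece J m\<^esub>"
  using J0 J3[of m] by (cases "m = 0") auto

lemma Sq_J_zero: "Sq J k m \<zero>\<^bsub>piece J m\<^esub> = \<zero>\<^bsub>piece J (m + k)\<^esub>"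
  by (rule linear_map_zero[OF unstable_moduleD(1)[OF J] unstable_moduleD(1)[OF J] unstable_moduleD(2)[OF J]])

lemma pre_tensor_simps [simp]:
  "p \<in> carrier (piece P n) \<longleftrightarrow> (\<forall>k\<in>Poly_Mapping.keys p. valid_key n k)"
  "p \<oplus>\<^bsub>piece P n\<^esub> q = p + q" "\<zero>\<^bsub>piece P n\<^esub> = 0"
  "c \<odot>\<^bsub>piece P n\<^esub> p = (if c = 0 then 0 else p)"
  by (simp_all add: pre_tensor_def valid_key_def map_bit_mult del: mult_bit_eq_and)

lemma pre_tensor_add: "p \<in> carrier (piece P n) \<Longrightarrow> q \<in> carrier (piece P n) \<Longrightarrow> p + q \<in> carrier (piece P n)"
  using keys_add[of p q] by auto

lemma module_pre_tensor: "module F2 (piece P n)"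
proof (rule F2_moduleI_carrier)
  show "p \<oplus>\<^bsub>piece P n\<^esub> q \<in> carrier (piece P n)"
    if "p \<in> carrier (piece P n)" "q \<in> carrier (piece P n)" for p q
    using pre_tensor_add[OF that] by simp
qed (simp_all add: add.assoc add.commute poly_mapping_bit_add_self)

lemma pre_tensor_sum:
  "(\<And>i. i \<in> A \<Longrightarrow> g i \<in> carrier (piece P n)) \<Longrightarrow> (\<Sum>i\<in>A. g i) \<in> carrier (piece P n)"
proof (induction A rule: infinite_finite_induct)
  case (insert i A)
  then have "g i + (\<Sum>i\<in>A. g i) \<in> carrier (piece P n)"
    by (intro pre_tensor_add) auto
  then show ?case
    using insert by simp
qed simp_all

lemma pre_tensor_single: "valid_key n k \<Longrightarrow> Poly_Mapping.single k 1 \<in> carrier (piece P n)"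
  by simp

lemma pre_tensor_Sq: "Sq P k n p =
    (\<Sum>(i, x, y)\<in>Poly_Mapping.keys p. \<Sum>b\<in>{..k}. Poly_Mapping.single (i + b, Sq HH b i x, Sq J (k - b) (n - i) y) 1)"
  by (simp add: pre_tensor_def split_beta lookup_keys_bit cong: sum.cong)

lemma pre_tensor_act: "act P j n h p = (\<Sum>(i, x, y)\<in>Poly_Mapping.keys p. Poly_Mapping.single (j + i, h * x, y) 1)"
  by (simp add: pre_tensor_def split_beta lookup_keys_bit act_HH cong: sum.cong)

lemma valid_key_Sq:
  assumes "valid_key n (i, x, y)" "b \<le> k"
  shows "valid_key (n + k) (i + b, Sq HH b i x, Sq J (k - b) (n - i) y)"
proof -
  have "(n + k) - (i + b) = (n - i) + (k - b)" "i + b \<le> n + k"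
    using assms by (auto simp: valid_key_def)
  moreover have "Sq HH b i x \<in> carrier (piece HH (i + b))"
    using assms(1) by (cases "of_nat (i choose b) :: bit")
      (auto simp: valid_key_def HH_carrier_iff Sq_HH power_add mult.commute)
  moreover have "Sq J (k - b) (n - i) y \<in> carrier (piece J ((n - i) + (k - b)))"
    using assms(1) by (intro unstable_moduleD(5)[OF J]) (simp add: valid_key_def)
  ultimately show ?thesis
    unfolding valid_key_def by (simp only: prod.case simp_thms)
qed

lemma valid_key_act:
  assumes "valid_key n (i, x, y)" "h \<in> carrier (piece HH j)"
  shows "valid_key (j + n) (j + i, h * x, y)"
  using assms by (auto simp: valid_key_def HH_carrier_iff power_add)

lemma pre_tensor_Sq_closed: "p \<in> carrier (piece P n) \<Longrightarrow> Sq P k n p \<in> carrier (piece P (n + k))"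
  unfolding pre_tensor_Sq
  by (intro pre_tensor_sum, clarify, intro pre_tensor_sum pre_tensor_single valid_key_Sq) auto

lemma pre_tensor_act_closed:
  "h \<in> carrier (piece HH j) \<Longrightarrow> p \<in> carrier (piece P n) \<Longrightarrow> act P j n h p \<in> carrier (piece P (j + n))"
  unfolding pre_tensor_act
  by (intro pre_tensor_sum, clarify, intro pre_tensor_single valid_key_act) auto

lemma bit_pair_add_self: "v + v = (0 :: bit \<times> bit)"
  by (simp only: prod_eq_iff fst_add snd_add bit_add_self fst_zero snd_zero)

abbreviation to_model :: "nat \<Rightarrow> (nat \<times> bit poly \<times> 'u \<Rightarrow>\<^sub>0 bit) \<Rightarrow> bit \<times> bit"
  where "to_model n \<equiv> keys_sum (weight n)"

lemmas to_model_add = keys_sum_add[of "weight n" for n, OF bit_pair_add_self]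
lemmas to_model_sum = keys_sum_sum[of "weight n" for n, OF bit_pair_add_self]

lemma model_sum:
  "(\<And>i. i \<in> A \<Longrightarrow> g i \<in> carrier (piece (model \<beta>) n)) \<Longrightarrow> (\<Sum>i\<in>A. g i) \<in> carrier (piece (model \<beta>) n)"
proof (induction A rule: infinite_finite_induct)
  case (insert i A)
  interpret F2_module "piece (model \<beta>) n"
    using module_model by blast
  have "g i \<oplus>\<^bsub>piece (model \<beta>) n\<^esub> (\<Sum>i\<in>A. g i) \<in> carrier (piece (model \<beta>) n)"
    using insert by (intro M.add.m_closed) auto
  then show ?case
    using insert by simp
qed (simp_all add: zero_prod_def)

lemma weight_carrier: "valid_key n k \<Longrightarrow> weight n k \<in> carrier (piece (model \<beta>) n)"
  by (auto simp: weight_def valid_key_def J_coord_def)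

lemma to_model_carrier: "p \<in> carrier (piece P n) \<Longrightarrow> to_model n p \<in> carrier (piece (model \<beta>) n)"
  unfolding keys_sum_def by (intro model_sum weight_carrier) simp

lemma to_model_linear: "linear_map (piece P n) (piece (model \<beta>) n) (to_model n)"
  unfolding linear_map_iff[OF module_pre_tensor module_model]
  using to_model_carrier to_model_add by (auto simp del: model_simps(1) pre_tensor_simps(1))

text \<open>The only nonzero square of positive index in \<open>J\<close> is Sq^1 on degree 1, which
  takes \<open>a\<close> to the nonzero class of degree 2.\<close>

lemma J_coord_Sq:
  assumes y: "y \<in> carrier (piece J m)"
  shows "J_coord 1 (m + j) (Sq J j m y) = (if j = 0 then J_coord 1 m y else 0)"
    and "J_coord 2 (m + j) (Sq J j m y) = (if j = 0 then J_coord 2 m y else if j = 1 then J_coord 1 m y else 0)"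
proof -
  have "m \<noteq> 1 \<Longrightarrow> m \<noteq> 2 \<Longrightarrow> y = \<zero>\<^bsub>piece J m\<^esub>" "m = 1 \<Longrightarrow> y = \<zero>\<^bsub>piece J m\<^esub> \<or> y = a"
    using J_zero_unless[OF y] y J1(1) by auto
  then consider "j = 0" | "j \<noteq> 0" "y = \<zero>\<^bsub>piece J m\<^esub>" | "j = 1" "m = 1" "y = a" |
      "j \<noteq> 0" "j \<noteq> 1" "m = 1" | "j \<noteq> 0" "m = 2"
    by blast
  note cases = this
  show "J_coord 1 (m + j) (Sq J j m y) = (if j = 0 then J_coord 1 m y else 0)"
    using cases unstable_moduleD(3)[OF J y] Sq_J_zero[of j m] by cases (auto simp: J_coord_def)
  show "J_coord 2 (m + j) (Sq J j m y) = (if j = 0 then J_coord 2 m y else if j = 1 then J_coord 1 m y else 0)"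
    using cases unstable_moduleD(3)[OF J y] Sq_J_zero[of j m] J1(2) J2(2)
    by cases (auto simp: J_coord_def numeral_2_eq_2)
qed

lemma sum_if_eq_atMost:
  fixes f :: "nat \<Rightarrow> 'b :: comm_monoid_add"
  shows "(\<Sum>b\<in>{..k}. if k - b = j then f b else 0) = (if j \<le> k then f (k - j) else 0)"
proof -
  have "(\<Sum>b\<in>{..k}. if k - b = j then f b else 0) = (\<Sum>b\<in>{..k}. if b = k - j then (if j \<le> k then f (k - j) else 0) else 0)"
    by (intro sum.cong) auto
  then show ?thesis
    by (simp add: sum.delta')
qed

text \<open>Of the Cartan sum on x \<otimes> y only b = k and b = k - 1 survive, because
  \<open>J\<close> has no squares beyond Sq^0 and Sq^1. The absent Sq^2 term is why
  \<open>\<beta>\<close> is 0 here.\<close>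

lemma weight_Sq:
  assumes "valid_key n (i, x, y)"
  shows "(\<Sum>b\<in>{..k}. weight (n + k) (i + b, Sq HH b i x, Sq J (k - b) (n - i) y)) =
    Sq (model 0) k n (weight n (i, x, y))"
proof -
  define m c where "m = n - i" and "c = coeff x i"
  have n: "n = i + m" and y: "y \<in> carrier (piece J m)" and x: "x = Polynomial.smult c (tt ^ i)"
    using assms HH_carrierE by (auto simp: valid_key_def m_def c_def)
  let ?p = "J_coord 1 m y" and ?q = "J_coord 2 m y"
  have summand: "weight (n + k) (i + b, Sq HH b i x, Sq J (k - b) (n - i) y) =
      ((if k - b = 0 then of_nat (i choose b) * c * ?p else 0),
       (if k - b = 0 then of_nat (i choose b) * c * ?q else 0) +
       (if k - b = 1 then of_nat (i choose b) * c * ?p else 0))" if "b \<le> k" for b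
  proof -
    have idx: "(n + k) - (i + b) = m + (k - b)" "n - i = m"
      using that n by auto
    have coeff: "coeff (Sq HH b i x) (i + b) = of_nat (i choose b) * c"
      by (simp add: Sq_HH x tt_power_eq_monom mult_monom smult_monom add.commute)
    show ?thesis
      unfolding weight_def prod.case idx coeff J_coord_Sq[OF y]
      by (simp del: mult_bit_eq_and add_bit_eq_xor)
  qed
  have "(\<Sum>b\<in>{..k}. weight (n + k) (i + b, Sq HH b i x, Sq J (k - b) (n - i) y)) =
      (\<Sum>b\<in>{..k}. ((if k - b = 0 then of_nat (i choose b) * c * ?p else 0),
       (if k - b = 0 then of_nat (i choose b) * c * ?q else 0) +
       (if k - b = 1 then of_nat (i choose b) * c * ?p else 0)))"
    by (intro sum.cong refl summand) simp
  also have "\<dots> = (of_nat (i choose k) * c * ?p,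
       of_nat (i choose k) * c * ?q + (if 1 \<le> k then of_nat (i choose (k - 1)) * c * ?p else 0))"
    unfolding sum_prod sum.distrib sum_if_eq_atMost by (simp only: le0 if_True diff_zero)
  also have "\<dots> = Sq (model 0) k n (weight n (i, x, y))"
  proof -
    have "weight n (i, x, y) = (c * ?p, c * ?q)"
      by (simp add: weight_def m_def c_def)
    \<comment> \<open>A nonzero coordinate fixes the degree of y, and with it the power i of
      t.\<close>
    moreover have "?p = 0 \<or> n - 1 = i" "?q = 0 \<or> n - 2 = i"
      using n by (auto simp: J_coord_def)
    ultimately show ?thesis
      by (cases "k = 0") (auto simp: model_def ac_simps simp del: mult_bit_eq_and add_bit_eq_xor)
  qed
  finally show ?thesis .
qed

lemma Sq_model_add: "Sq (model \<beta>) k n (v + w) = Sq (model \<beta>) k n v + Sq (model \<beta>) k n w"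
  by (cases v; cases w) (simp add: model_def algebra_simps del: mult_bit_eq_and add_bit_eq_xor)

lemma Sq_model_sum: "Sq (model \<beta>) k n (\<Sum>i\<in>A. g i) = (\<Sum>i\<in>A. Sq (model \<beta>) k n (g i))"
proof (induction A rule: infinite_finite_induct)
  case (insert i A)
  then show ?case by (simp add: Sq_model_add)
qed (simp_all add: model_def zero_prod_def)

lemma act_model_sum: "act (model \<beta>) j n h (\<Sum>i\<in>A. g i) = (\<Sum>i\<in>A. act (model \<beta>) j n h (g i))"
proof (induction A rule: infinite_finite_induct)
  case (insert i A)
  have "act (model \<beta>) j n h (v + w) = act (model \<beta>) j n h v + act (model \<beta>) j n h w" for v w
    by (cases v; cases w) (simp add: model_def distrib_left del: mult_bit_eq_and add_bit_eq_xor)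
  with insert show ?case by simp
qed (simp_all add: model_def zero_prod_def)

lemma to_model_Sq:
  assumes "p \<in> carrier (piece P n)"
  shows "to_model (n + k) (Sq P k n p) = Sq (model 0) k n (to_model n p)"
proof -
  have "to_model (n + k) (Sq P k n p) = (\<Sum>(i, x, y)\<in>Poly_Mapping.keys p.
      \<Sum>b\<in>{..k}. weight (n + k) (i + b, Sq HH b i x, Sq J (k - b) (n - i) y))"
    unfolding pre_tensor_Sq by (simp add: to_model_sum split_beta keys_sum_single)
  also have "\<dots> = (\<Sum>e\<in>Poly_Mapping.keys p. Sq (model 0) k n (weight n e))"
    using assms weight_Sq by (intro sum.cong) auto
  finally show ?thesis
    by (simp add: Sq_model_sum keys_sum_def)
qed

lemma to_model_act:
  assumes "h \<in> carrier (piece HH j)" "p \<in> carrier (piece P n)"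
  shows "to_model (j + n) (act P j n h p) = act (model 0) j n h (to_model n p)"
proof -
  have "weight (j + n) (j + i, h * x, y) = act (model 0) j n h (weight n (i, x, y))"
    if "valid_key n (i, x, y)" for i x y
  proof -
    have "coeff (h * x) (j + i) = coeff h j * coeff x i"
      using assms(1) that by (auto simp: valid_key_def HH_carrier_iff tt_power_eq_monom mult_monom)
    then show ?thesis
      by (simp add: weight_def model_def mult.assoc del: mult_bit_eq_and)
  qed
  then have "(\<Sum>(i, x, y)\<in>Poly_Mapping.keys p. weight (j + n) (j + i, h * x, y)) =
      (\<Sum>e\<in>Poly_Mapping.keys p. act (model 0) j n h (weight n e))"
    using assms(2) by (intro sum.cong) auto
  then show ?thesis
    unfolding pre_tensor_act by (simp add: to_model_sum split_beta keys_sum_single act_model_sum keys_sum_def[of _ p])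
qed

text \<open>The normal form p t^(n-1) \<otimes> a + q t^(n-2) \<otimes> Sq^1 a. Where an exponent
  truncates, the corresponding coordinate of a model element is zero and the term drops out.\<close>

definition from_model :: "nat \<Rightarrow> bit \<times> bit \<Rightarrow> nat \<times> bit poly \<times> 'u \<Rightarrow>\<^sub>0 bit"
  where "from_model n v = Poly_Mapping.single (n - 1, tt ^ (n - 1), a) (fst v) +
    Poly_Mapping.single (n - 2, tt ^ (n - 2), Sq J 1 1 a) (snd v)"

lemma from_model_add: "from_model n (v + w) = from_model n v + from_model n w"
  by (simp only: from_model_def fst_add snd_add single_add ac_simps)

lemma from_model_sum: "from_model n (\<Sum>i\<in>A. g i) = (\<Sum>i\<in>A. from_model n (g i))"
proof (induction A rule: infinite_finite_induct)
  case (insert i A)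
  then show ?case by (simp add: from_model_add)
qed (simp_all add: from_model_def)

lemma generators_valid:
  "1 \<le> n \<Longrightarrow> valid_key n (n - 1, tt ^ (n - 1), a)" "2 \<le> n \<Longrightarrow> valid_key n (n - 2, tt ^ (n - 2), Sq J 1 1 a)"
  using J1 J2 by (auto simp: valid_key_def)

lemma from_model_carrier:
  assumes "v \<in> carrier (piece (model \<beta>) n)"
  shows "from_model n v \<in> carrier (piece P n)"
  unfolding from_model_def
proof (rule pre_tensor_add)
  show "Poly_Mapping.single (n - 1, tt ^ (n - 1), a) (fst v) \<in> carrier (piece P n)"
    using assms generators_valid(1)[of n] by (cases "fst v") (auto simp: not_less)
  show "Poly_Mapping.single (n - 2, tt ^ (n - 2), Sq J 1 1 a) (snd v) \<in> carrier (piece P n)"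
    using assms generators_valid(2)[of n] by (cases "snd v") (auto simp: not_less)
qed

lemma to_model_from_model:
  assumes "v \<in> carrier (piece (model \<beta>) n)"
  shows "to_model n (from_model n v) = v"
proof -
  have "to_model n (Poly_Mapping.single (n - 1, tt ^ (n - 1), a) (fst v)) = (fst v, 0)"
  proof (cases "fst v = 0")
    case False
    then have "n - (n - 1) = 1"
      using assms by (cases "n = 0") auto
    then show ?thesis
      using False J1(2) by (simp add: keys_sum_single weight_def J_coord_def tt_power_eq_monom)
  qed (simp add: keys_sum_0 zero_prod_def)
  moreover have "to_model n (Poly_Mapping.single (n - 2, tt ^ (n - 2), Sq J 1 1 a) (snd v)) = (0, snd v)"
  proof (cases "snd v = 0")
    case False
    then have "n - (n - 2) = 2"
      using assms by (cases "n < 2") auto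
    then show ?thesis
      using False J2(2) by (simp add: keys_sum_single weight_def J_coord_def tt_power_eq_monom)
  qed (simp add: keys_sum_0 zero_prod_def)
  ultimately show ?thesis
    by (simp add: from_model_def to_model_add prod_eq_iff)
qed

abbreviation relations :: "nat \<Rightarrow> (nat \<times> bit poly \<times> 'u \<Rightarrow>\<^sub>0 bit) set"
  where "relations n \<equiv> subspace_span (piece P n) (bilinearity_relations HH J n)"

lemma weight_add_left: "weight n (i, x + x', y) = weight n (i, x, y) + weight n (i, x', y)"
  by (simp add: weight_def distrib_right del: mult_bit_eq_and add_bit_eq_xor)

text \<open>A piece of \<open>J\<close> has at most one nonzero element, so one summand is zero or
  the two coincide and cancel.\<close>

lemma J_coord_add:
  assumes "y \<in> carrier (piece J m)" "y' \<in> carrier (piece J m)"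
  shows "J_coord d m (y \<oplus>\<^bsub>piece J m\<^esub> y') = J_coord d m y + J_coord d m y'"
proof -
  consider "y = \<zero>\<^bsub>piece J m\<^esub>" | "y' = \<zero>\<^bsub>piece J m\<^esub>" | "y = y'"
    using assms J_zero_unless[of y m] J1(1) J2(1) by (cases "m = 1"; cases "m = 2") auto
  then show ?thesis
    using assms J.add_self[of y m] by cases (auto simp: J_coord_def)
qed

lemma weight_add_right:
  assumes "y \<in> carrier (piece J (n - i))" "y' \<in> carrier (piece J (n - i))"
  shows "weight n (i, x, y \<oplus>\<^bsub>piece J (n - i)\<^esub> y') = weight n (i, x, y) + weight n (i, x, y')"
  by (simp add: weight_def J_coord_add[OF assms] distrib_left del: mult_bit_eq_and add_bit_eq_xor)

lemma weight_zero: "weight n (i, 0, y) = 0" "weight n (i, x, \<zero>\<^bsub>piece J (n - i)\<^esub>) = 0"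
  by (simp_all add: weight_def J_coord_def zero_prod_def)

text \<open>Signs disappear over F_2, and by the bilinearity of \<open>weight\<close> the weights in
  each relation cancel in pairs or vanish.\<close>

lemma relations_kernel:
  assumes "r \<in> bilinearity_relations HH J n"
  shows "r \<in> carrier (piece P n)" "to_model n r = 0"
proof -
  let ?e = "\<lambda>i x y. Poly_Mapping.single (i, x, y) (1 :: bit)"
  obtain i x y where i: "i \<le> n" and x: "x \<in> carrier (piece HH i)" and y: "y \<in> carrier (piece J (n - i))"
    and r: "(\<exists>x'\<in>carrier (piece HH i). r = ?e i (x + x') y + ?e i x y + ?e i x' y) \<or>
      (\<exists>y'\<in>carrier (piece J (n - i)). r = ?e i x (y \<oplus>\<^bsub>piece J (n - i)\<^esub> y') + ?e i x y + ?e i x y') \<or>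
      (\<exists>c. r = ?e i (Polynomial.smult c x) y + (if c = 0 then 0 else ?e i x y)) \<or>
      (\<exists>c. r = ?e i x (c \<odot>\<^bsub>piece J (n - i)\<^esub> y) + (if c = 0 then 0 else ?e i x y))"
    using assms unfolding bilinearity_relations_def Let_def poly_mapping_bit_diff map_bit_mult HH_add
    by blast
  have v: "?e i u w \<in> carrier (piece P n)" if "u \<in> carrier (piece HH i)" "w \<in> carrier (piece J (n - i))" for u w
    using that i by (simp add: valid_key_def)
  have add: "u + u' \<in> carrier (piece HH i)" if "u \<in> carrier (piece HH i)" "u' \<in> carrier (piece HH i)" for u u'
    using that by (auto simp: HH_carrier_iff bit_poly_add_self)
  have zero: "0 \<in> carrier (piece HH i)"
    by (simp add: HH_carrier_iff)
  have e0: "0 \<in> carrier (piece P n)"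
    by simp
  note s = keys_sum_single keys_sum_0 weight_add_left weight_zero to_model_add bit_pair_add_self
  have "r \<in> carrier (piece P n) \<and> to_model n r = 0"
    using r
  proof (elim disjE bexE exE)
    fix x' assume "x' \<in> carrier (piece HH i)" "r = ?e i (x + x') y + ?e i x y + ?e i x' y"
    then show ?thesis
      using x y bit_pair_add_self[of "weight n (i, x, y) + weight n (i, x', y)"]
      by (auto simp: s add.assoc simp del: pre_tensor_simps(1) intro!: pre_tensor_add v add)
  next
    fix y' assume y': "y' \<in> carrier (piece J (n - i))"
      "r = ?e i x (y \<oplus>\<^bsub>piece J (n - i)\<^esub> y') + ?e i x y + ?e i x y'"
    then show ?thesis
      using x y bit_pair_add_self[of "weight n (i, x, y) + weight n (i, x, y')"]
      by (auto simp: s weight_add_right add.assoc simp del: pre_tensor_simps(1) intro!: pre_tensor_add v)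
  next
    fix c assume "r = ?e i (Polynomial.smult c x) y + (if c = 0 then 0 else ?e i x y)"
    then show ?thesis
      using x y zero e0 by (cases c) (auto simp: s simp del: pre_tensor_simps(1) intro!: pre_tensor_add v)
  next
    fix c assume "r = ?e i x (c \<odot>\<^bsub>piece J (n - i)\<^esub> y) + (if c = 0 then 0 else ?e i x y)"
    then show ?thesis
      using x y e0 by (cases c) (auto simp: s J.smult_bit simp del: pre_tensor_simps(1) intro!: pre_tensor_add v)
  qed
  then show "r \<in> carrier (piece P n)" "to_model n r = 0"
    by blast+
qed

lemma relations_submodule: "submodule (relations n) F2 (piece P n)"
  using relations_kernel(1) by (intro subspace_span_submodule module_pre_tensor subsetI)

text \<open>In the free space a key with a zero entry is not itself zero. It is the scalar relation
  for c = 0, whose second term vanishes.\<close>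

lemma single_zero_relations:
  assumes "i \<le> n" "x \<in> carrier (piece HH i)" "y \<in> carrier (piece J (n - i))"
    and "x = 0 \<or> y = \<zero>\<^bsub>piece J (n - i)\<^esub>"
  shows "Poly_Mapping.single (i, x, y) 1 \<in> relations n"
proof -
  let ?e = "\<lambda>i x y. Poly_Mapping.single (i, x, y) (1 :: bit)"
  have "?e i x y \<in> bilinearity_relations HH J n"
    using assms(4)
  proof
    assume "x = 0"
    then have "?e i x y = ?e i (0 \<odot>\<^bsub>piece HH i\<^esub> x) y - Poly_Mapping.map ((*) 0) (?e i x y)"
      by (simp add: map_bit_mult del: mult_bit_eq_and)
    then show ?thesis
      using assms(1-3) unfolding bilinearity_relations_def Let_def by blast
  next
    assume "y = \<zero>\<^bsub>piece J (n - i)\<^esub>"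
    then have "?e i x y = ?e i x (0 \<odot>\<^bsub>piece J (n - i)\<^esub> y) - Poly_Mapping.map ((*) 0) (?e i x y)"
      by (simp add: map_bit_mult J.smult_bit del: mult_bit_eq_and)
    then show ?thesis
      using assms(1-3) unfolding bilinearity_relations_def Let_def by blast
  qed
  then show ?thesis
    by (rule subsetD[OF subspace_span_superset])
qed

text \<open>If an entry is zero, the weight is zero and the key is a relation. Otherwise x = t^i and
  y is \<open>a\<close> or Sq^1 a, so the key already is its normal form and the sum vanishes in
  characteristic 2.\<close>

lemma single_normal_form:
  assumes "valid_key n k"
  shows "Poly_Mapping.single k 1 + from_model n (weight n k) \<in> relations n"
proof -
  obtain i x y where k: "k = (i, x, y)"
    by (cases k)
  have i: "i \<le> n" and x: "x \<in> carrier (piece HH i)" and y: "y \<in> carrier (piece J (n - i))"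
    using assms by (auto simp: k valid_key_def)
  show ?thesis
  proof (cases "x = 0 \<or> y = \<zero>\<^bsub>piece J (n - i)\<^esub>")
    case True
    then have "weight n k = 0"
      using weight_zero by (auto simp: k)
    then show ?thesis
      using single_zero_relations[OF i x y True] by (simp add: k from_model_def)
  next
    case False
    then have x_eq: "x = tt ^ i" "coeff x i = 1"
      using x by (auto simp: HH_carrier_iff tt_power_eq_monom)
    have "n - i = 1 \<or> n - i = 2"
      using J_zero_unless[OF y] False by blast
    then have "from_model n (weight n k) = Poly_Mapping.single k 1"
    proof
      assume *: "n - i = 1"
      then have "y = a" "i = n - 1"
        using y J1 False by auto
      then show ?thesis
        using * False x_eq by (simp add: k weight_def J_coord_def from_model_def)
    next
      assume *: "n - i = 2"
      then have "y = Sq J 1 1 a" "i = n - 2"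
        using y J2 False by auto
      then show ?thesis
        using * False x_eq by (simp add: k weight_def J_coord_def from_model_def)
    qed
    then show ?thesis
      using submodule_zero[OF relations_submodule] by (simp add: poly_mapping_bit_add_self)
  qed
qed

text \<open>If p has image zero, adding \<open>from_model\<close> of that image changes nothing, and
  the sum splits over the keys of p into the relations of \<open>single_normal_form\<close>. The
  converse holds because the kernel is a subspace containing the generating relations.\<close>

lemma to_model_kernel:
  assumes p: "p \<in> carrier (piece P n)"
  shows "to_model n p = 0 \<longleftrightarrow> p \<in> relations n"
proof
  interpret P: F2_module "piece P n"
    using module_pre_tensor by blast
  have sum: "(\<Sum>k\<in>A. g k) \<in> relations n" if "\<And>k. k \<in> A \<Longrightarrow> g k \<in> relations n" for A :: "(nat \<times> bit poly \<times> 'u) set" and g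
    using that
  proof (induction A rule: infinite_finite_induct)
    case (insert k A)
    then show ?case
      using P.submoduleE(5)[OF relations_submodule, of "g k" "\<Sum>k\<in>A. g k"] by simp
  qed (use submodule_zero[OF relations_submodule] in simp_all)
  assume "to_model n p = 0"
  then have "from_model n (to_model n p) = 0"
    by (simp add: from_model_def)
  then have "p = p + from_model n (to_model n p)"
    by simp
  also have "\<dots> = (\<Sum>k\<in>Poly_Mapping.keys p. Poly_Mapping.single k 1 + from_model n (weight n k))"
    by (simp add: sum.distrib sum_single_keys keys_sum_def from_model_sum)
  also have "\<dots> \<in> relations n"
    using p by (intro sum single_normal_form) simp
  finally show "p \<in> relations n" .
next
  interpret P: F2_module "piece P n"
    using module_pre_tensor by blast
  have "relations n \<subseteq> {q \<in> carrier (piece P n). to_model n q = 0}"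
  proof (intro subspace_span_least P.submoduleI_F2)
    show "bilinearity_relations HH J n \<subseteq> {q \<in> carrier (piece P n). to_model n q = 0}"
      using relations_kernel by blast
    fix u v assume "u \<in> {q \<in> carrier (piece P n). to_model n q = 0}" "v \<in> {q \<in> carrier (piece P n). to_model n q = 0}"
    then show "u \<oplus>\<^bsub>piece P n\<^esub> v \<in> {q \<in> carrier (piece P n). to_model n q = 0}"
      using pre_tensor_add[of u n v] by (simp add: to_model_add)
  qed (auto simp: keys_sum_0)
  then show "p \<in> relations n \<Longrightarrow> to_model n p = 0"
    by blast
qed

lemma model_tensor:
  "\<exists>f. HA_map (model 0) (tensor HH J) f \<and>
    (\<forall>n. bij_betw (f n) (carrier (piece (model 0) n)) (carrier (piece (tensor HH J) n)))"
  unfolding tensor_def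
proof (rule quotient_hmod_isomorphism[where \<phi> = to_model])
  show "to_model n ` carrier (piece P n) = carrier (piece (model 0) n)" for n
  proof (intro subset_antisym subsetI)
    fix v assume v: "v \<in> carrier (piece (model 0) n)"
    show "v \<in> to_model n ` carrier (piece P n)"
      using to_model_from_model[OF v] from_model_carrier[OF v] by (intro image_eqI[where x = "from_model n v"]) auto
  qed (use to_model_carrier in blast)
  show "to_model n p = \<zero>\<^bsub>piece (model 0) n\<^esub> \<longleftrightarrow> p \<in> relations n" if "p \<in> carrier (piece P n)" for n p
    using to_model_kernel[OF that] by simp
qed (fact module_pre_tensor module_model relations_submodule to_model_linear to_model_Sq to_model_act
    pre_tensor_Sq_closed pre_tensor_act_closed)+

end

section \<open>Comparison of E with the two candidates\<close>

lemma isomorphic_via_model: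
  fixes E :: "'e hmod" and F :: "'f hmod"
  assumes "HA_map (model \<beta>) E g"
    and "\<And>n. bij_betw (g n) (carrier (piece (model \<beta>) n)) (carrier (piece E n))"
    and "HA_map (model \<beta>) F f"
    and "\<And>n. bij_betw (f n) (carrier (piece (model \<beta>) n)) (carrier (piece F n))"
  shows "HA_isomorphic E F"
  by (rule HA_map_compose_inv[OF module_model _ _ assms]) (rule model_Sq_closed model_act_closed, assumption)+

theorem proposition1p3:
  fixes J :: "'u gmod" and E :: "'e hmod"
  assumes "infinite (UNIV :: 'u set)"
    and "brown_gitler 2 J"
    and "unstable_HA_module E"
    and "free_H_module E"
    and "A_isomorphic (reduction E) J"
  shows "HA_isomorphic E (tensor HH J) \<or>
    HA_isomorphic E
      (generated_HA_submodule (direct_sum HH (suspension HH)) {(1, (tt, 1)), (2, (tt ^ 2, 0))})"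
proof -
  have J: "unstable_module J"
    by (rule brown_gitlerD(1)[OF assms(2)])
  obtain a where a: "carrier (piece J 0) = {\<zero>\<^bsub>piece J 0\<^esub>}"
    "carrier (piece J 1) = {\<zero>\<^bsub>piece J 1\<^esub>, a}" "a \<noteq> \<zero>\<^bsub>piece J 1\<^esub>"
    "carrier (piece J 2) = {\<zero>\<^bsub>piece J 2\<^esub>, Sq J 1 1 a}" "Sq J 1 1 a \<noteq> \<zero>\<^bsub>piece J 2\<^esub>"
    "\<And>n. 3 \<le> n \<Longrightarrow> carrier (piece J n) = {\<zero>\<^bsub>piece J n\<^esub>}"
    using brown_gitler_2_structure[OF assms(1,2)] by metis
  interpret HA_module E
    by unfold_locales (rule assms(3))
  obtain x where x: "J2_type E x"
    using reduction_J2_type[OF assms(4,5) J a] by blast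
  obtain \<beta> g where g0: "HA_map (model \<beta>) E g \<and>
      (\<forall>n. bij_betw (g n) (carrier (piece (model \<beta>) n)) (carrier (piece E n)))"
    using J2_type.model_isomorphism[OF x] by (elim exE) rule
  note g = conjunct1[OF g0] conjunct2[OF g0, rule_format]
  note iso = isomorphic_via_model[OF g]
  show ?thesis
  \<comment> \<open>The coefficient of t^2 y in Sq^2 y decides: 0 gives the tensor product, 1 the
    submodule.\<close>
  proof (cases "\<beta> = 0")
    case True
    then show ?thesis
      using model_tensor[OF J a] iso by blast
  next
    case False
    then have 1: "\<beta> = 1"
      by simp
    show ?thesis
      using iso[unfolded 1, OF model_generated] by blast
  qed
qed

end
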